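(* Let $\epsilon>0$ (with $1/\epsilon$ the light speed), let $k\in(0,1/\epsilon)$ (the sound speed) and $M>0$ (the black hole mass). For any radius $r_0>2M$, density $\rho_0>0$ and velocity $v_0$ with $0\le v_0<1/\epsilon$ and $v_0\ne k$, there exists a unique (smooth) steady state solution $$\rho=\rho(r;r_0,\rho_0,v_0),\qquad v=v(r;r_0,\rho_0,v_0)$$ of the steady Euler system on a Schwarzschild background (see context) satisfying $\rho(r_0)=\rho_0$ and $v(r_0)=v_0$. Moreover $\mathrm{sgn}(v(r)-k)=\mathrm{sgn}(v_0-k)$ for all $r$ in the domain of the solution, and this domain is as follows. 1. (Regime without sonic point.) If $P_\epsilon(r_0,v_0)>0$, the solution is defined on the whole interval $(2M,+\infty)$. 2. (Regime with sonic points.) If $P_\epsilon(r_0,v_0)\le0$, the solution is defined on the interval $\Pi\subsetneq(2M,+\infty)$ given by $$\Pi=\begin{cases}(2M,\underline r_* ),& r_0<\frac{2-\kappa}{1-\kappa}M,\\ (\overline r_*,+\infty),& r_0\ge\frac{2-\kappa}{1-\kappa}M,\end{cases}$$ where $\underline r_*\le\overline r_*$ are the two sonic points; moreover $v(r)$ tends to $k$ as $r$ approaches the sonic radius ($\underline r_*$ or $\overline r_*$, respectively) bounding $\Pi$.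
   Context: Put $\kappa=\frac{1-\epsilon^2k^2}{1+\epsilon^2k^2}\in(0,1)$. The steady Euler system (unknowns $\rho(r)>0$, $|v(r)|<1/\epsilon$, $r>2M$) is $$\frac{d}{dr}\Big(r(r-2M)\frac{1+\epsilon^2k^2}{1-\epsilon^2v^2}\rho v\Big)=0,$$ $$\frac{d}{dr}\Big((r-2M)^2\frac{v^2+k^2}{1-\epsilon^2v^2}\rho\Big)=\frac{M}{r}\frac{r-2M}{1-\epsilon^2v^2}\Big(3\rho v^2+3k^2\rho-\epsilon^{-2}\rho-\epsilon^2k^2\rho v^2\Big)+\frac{2k^2}{r}(r-2M)^2\rho .$$ For $r_0>2M$ and $0<v_0<1/\epsilon$, $$P_\epsilon(r_0,v_0)=\ln\Big(\frac{(2-\kappa)^2}{(1-\kappa)^2}\frac{M^2k}{r_0^2v_0}\Big)+\frac{\kappa}{1-\kappa}\ln\Big(\frac{2(2-\kappa)}{1+\kappa}\,\frac{r_0-2M}{r_0(1-\epsilon^2v_0^2)}\Big),$$ with the convention $P_\epsilon(r_0,0)=+\infty$. A sonic point is a radius $r>2M$ solving $$\ln\frac{1-\epsilon^2v_0^2}{1-\epsilon^2k^2}+\frac{1-\kappa}{\kappa}\ln\frac{v_0}{k}=\frac{1-\kappa}{\kappa}\ln\frac{r^2}{r_0^2}+\ln\frac{r(r_0-2M)}{r_0(r-2M)} .$$ When $v_0>0$, $v_0\neq k$ and $P_\epsilon(r_0,v_0)\le0$ there are two (possibly coinciding) sonic points, denoted $\underline r_*\le\overline r_*$.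
   Formalization: When P_ε(r_0,v_0)=0 the smooth solution continues through the double sonic point with v−k changing sign, so in this case only, Π is stated as the maximal domain among solutions with v≠k everywhere; uniqueness on overlaps stays unrestricted. *)

theory Defs
  imports "HOL-Analysis.Analysis" "HOL-Library.Extended_Real"
begin

definition kappa :: "real \<Rightarrow> real \<Rightarrow> real" where
  "kappa \<epsilon> k = (1 - \<epsilon>^2 * k^2) / (1 + \<epsilon>^2 * k^2)"

text \<open>Only meaningful for open \<open>I\<close>: derivatives of all orders exist at every point of \<open>I\<close>.\<close>

definition smooth_on_open :: "(real \<Rightarrow> real) \<Rightarrow> real set \<Rightarrow> bool" where
  "smooth_on_open f I \<longleftrightarrow> (\<forall>n. \<forall>r\<in>I. (deriv ^^ n) f field_differentiable (at r))"

text \<open>Smooth solutions of the steady Euler system on an open interval \<open>I\<close> of radii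
  outside the horizon; the values of \<open>\<rho>\<close> and \<open>v\<close> off \<open>I\<close> are irrelevant.
  Solutions are allowed to be sonic (\<open>v r = k\<close>) somewhere.\<close>

definition steady_Euler ::
  "real \<Rightarrow> real \<Rightarrow> real \<Rightarrow> real set \<Rightarrow> (real \<Rightarrow> real) \<Rightarrow> (real \<Rightarrow> real) \<Rightarrow> bool" where
  "steady_Euler \<epsilon> k M I \<rho> v \<longleftrightarrow>
     open I \<and> is_interval I \<and> I \<subseteq> {2 * M<..} \<and>
     smooth_on_open \<rho> I \<and> smooth_on_open v I \<and>
     (\<forall>r\<in>I. \<rho> r > 0 \<and> \<bar>v r\<bar> < 1 / \<epsilon>) \<and>
     (\<forall>r\<in>I.
        ((\<lambda>s. s * (s - 2 * M) * ((1 + \<epsilon>^2 * k^2) / (1 - \<epsilon>^2 * (v s)^2)) * \<rho> s * v s)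
           has_real_derivative 0) (at r) \<and>
        ((\<lambda>s. (s - 2 * M)^2 * (((v s)^2 + k^2) / (1 - \<epsilon>^2 * (v s)^2)) * \<rho> s)
           has_real_derivative
           (M / r * ((r - 2 * M) / (1 - \<epsilon>^2 * (v r)^2)) *
              (3 * \<rho> r * (v r)^2 + 3 * k^2 * \<rho> r - \<rho> r / \<epsilon>^2 - \<epsilon>^2 * k^2 * \<rho> r * (v r)^2)
            + 2 * k^2 / r * (r - 2 * M)^2 * \<rho> r)) (at r))"

definition steady_Euler_through ::
  "real \<Rightarrow> real \<Rightarrow> real \<Rightarrow> real \<Rightarrow> real \<Rightarrow> real \<Rightarrow>
     real set \<Rightarrow> (real \<Rightarrow> real) \<Rightarrow> (real \<Rightarrow> real) \<Rightarrow> bool" where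
  "steady_Euler_through \<epsilon> k M r0 \<rho>0 v0 I \<rho> v \<longleftrightarrow>
     steady_Euler \<epsilon> k M I \<rho> v \<and> r0 \<in> I \<and> \<rho> r0 = \<rho>0 \<and> v r0 = v0"

definition P_sonic :: "real \<Rightarrow> real \<Rightarrow> real \<Rightarrow> real \<Rightarrow> real \<Rightarrow> ereal" where
  "P_sonic \<epsilon> k M r0 v0 =
     (if v0 = 0 then \<infinity>
      else let \<kappa> = kappa \<epsilon> k in
        ereal (ln ((2 - \<kappa>)^2 / (1 - \<kappa>)^2 * (M^2 * k / (r0^2 * v0)))
               + \<kappa> / (1 - \<kappa>) *
                 ln (2 * (2 - \<kappa>) / (1 + \<kappa>) * ((r0 - 2 * M) / (r0 * (1 - \<epsilon>^2 * v0^2))))))"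

text \<open>Meaningful for \<open>v0 > 0\<close>; for \<open>v0 = 0\<close> one has \<open>P_sonic = \<infinity>\<close> and sonic points play no role.\<close>

definition sonic_points :: "real \<Rightarrow> real \<Rightarrow> real \<Rightarrow> real \<Rightarrow> real \<Rightarrow> real set" where
  "sonic_points \<epsilon> k M r0 v0 =
     (let \<kappa> = kappa \<epsilon> k in
      {r. r > 2 * M \<and>
          ln ((1 - \<epsilon>^2 * v0^2) / (1 - \<epsilon>^2 * k^2)) + (1 - \<kappa>) / \<kappa> * ln (v0 / k)
          = (1 - \<kappa>) / \<kappa> * ln (r^2 / r0^2) + ln (r * (r0 - 2 * M) / (r0 * (r - 2 * M)))})"

text \<open>\<open>I\<close> is the domain of the solution through the given data: any smooth solution with the same
  data agrees with \<open>(\<rho>, v)\<close> where both are defined, and has its domain inside \<open>I\<close>.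
  The sole exception to the latter is \<open>P_sonic = 0\<close>, where the two sonic points coincide and
  the solution continues smoothly through the sonic point, with \<open>v - k\<close> changing sign; there
  the domain is maximal among solutions that are nowhere sonic.\<close>

definition is_the_steady_state ::
  "real \<Rightarrow> real \<Rightarrow> real \<Rightarrow> real \<Rightarrow> real \<Rightarrow> real \<Rightarrow>
     real set \<Rightarrow> (real \<Rightarrow> real) \<Rightarrow> (real \<Rightarrow> real) \<Rightarrow> bool" where
  "is_the_steady_state \<epsilon> k M r0 \<rho>0 v0 I \<rho> v \<longleftrightarrow>
     steady_Euler_through \<epsilon> k M r0 \<rho>0 v0 I \<rho> v \<and>
     (\<forall>J \<sigma> w. steady_Euler_through \<epsilon> k M r0 \<rho>0 v0 J \<sigma> w \<longrightarrow>
        (\<forall>r\<in>I \<inter> J. \<sigma> r = \<rho> r \<and> w r = v r) \<and>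
        (P_sonic \<epsilon> k M r0 v0 \<noteq> 0 \<or> (\<forall>r\<in>J. w r \<noteq> k) \<longrightarrow> J \<subseteq> I))"

end

theory Submission
  imports Defs
begin

text \<open>Dividing the momentum equation by the conserved mass flux turns the steady Euler system, wherever
the fluid moves, into a separable equation for the velocity alone,
\<open>g'(v) v' = h'(r)\<close> with
\<open>g(v) = - b ln v - ln (1 - \<epsilon>\<^sup>2v\<^sup>2)\<close>,
\<open>h(r) = (1 + 2b) ln r - ln (r - 2M)\<close> and \<open>b = (1 - \<kappa>)/\<kappa>\<close>.
So \<open>g(v(r)) - h(r)\<close> is a first integral and everything can be read off the graphs of
\<open>g\<close> and \<open>h\<close>. Both are valleys: they decrease strictly to one minimum, then increase strictly, and
are unbounded on either side. The minimum of \<open>g\<close> is at the sound speed \<open>k\<close>, that of \<open>h\<close> at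
\<open>(2 - \<kappa>)/(1 - \<kappa>) M\<close>.

On a solution, \<open>g(v(r)) - g(k) = h(r) - L\<close>, where the level
\<open>L = h(r\<^sub>0) - g(v\<^sub>0) + g(k)\<close> depends on the data only. Since \<open>g \<ge> g(k)\<close>, no solution, sonic or
not, can enter the region \<open>h < L\<close>, and it is sonic exactly where \<open>h = L\<close>; these radii are the
sonic points. Conversely, where \<open>h > L\<close>, inverting the branch of \<open>g\<close> on the side of \<open>k\<close> that
contains \<open>v\<^sub>0\<close> produces the solution. Finally \<open>b P\<close> equals \<open>min h - L\<close>. If \<open>P > 0\<close>, then
\<open>h > L\<close> everywhere. Otherwise \<open>h > L\<close> holds on two intervals, one below and one above the sonic
points, and the domain is the one containing \<open>r\<^sub>0\<close>. For \<open>P < 0\<close> no larger domain is possible,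
because \<open>h < L\<close> between the sonic points; for \<open>P = 0\<close> they coincide and a solution can leave the
domain only by being sonic there.

Uniqueness on a common domain needs no Lipschitz theory: a solution that is never sonic stays on its
branch of \<open>g\<close>, where \<open>g\<close> is injective, and the conserved flux then determines the density.
Smoothness holds because the velocity solves an equation with rational right-hand side. A fluid at
rest stays at rest, and its density solves a linear equation that can be integrated explicitly.\<close>

section \<open>Functions with a single valley\<close>

definition valley :: "real set \<Rightarrow> (real \<Rightarrow> real) \<Rightarrow> real \<Rightarrow> bool" where
  "valley D f m \<longleftrightarrow> open D \<and> is_interval D \<and> m \<in> D \<and> continuous_on D f \<and>
     (\<forall>x\<in>D. \<forall>y\<in>D. x < y \<and> y \<le> m \<longrightarrow> f y < f x) \<and>
     (\<forall>x\<in>D. \<forall>y\<in>D. m \<le> x \<and> x < y \<longrightarrow> f x < f y) \<and>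
     (\<forall>y. \<exists>x\<in>D. x < m \<and> y < f x) \<and> (\<forall>y. \<exists>x\<in>D. m < x \<and> y < f x)"

lemma valleyI_derivative:
  assumes D: "open D" "is_interval D" "m \<in> D"
    and der: "\<And>x. x \<in> D \<Longrightarrow> (f has_real_derivative (x - m) * q x) (at x)"
    and q: "\<And>x. x \<in> D \<Longrightarrow> q x > 0"
    and "\<And>y. \<exists>x\<in>D. x < m \<and> y < f x" "\<And>y. \<exists>x\<in>D. m < x \<and> y < f x"
  shows "valley D f m"
proof -
  have cont: "continuous_on D f"
    by (meson DERIV_isCont continuous_at_imp_continuous_on der)
  have sub: "{x..y} \<subseteq> D" if "x \<in> D" "y \<in> D" for x y
    using D(2) that unfolding is_interval_1 by (meson atLeastAtMost_iff subsetI)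
  have "f y < f x" if "x \<in> D" "y \<in> D" "x < y" "y \<le> m" for x y
  proof (rule DERIV_neg_imp_decreasing_open[OF \<open>x < y\<close>])
    fix z assume z: "x < z" "z < y"
    then have "z \<in> D" using sub[OF that(1,2)] by auto
    then show "\<exists>d. DERIV f z :> d \<and> d < 0"
      using der[of z] q[of z] z that by (intro exI[of _ "(z - m) * q z"]) (auto simp: mult_less_0_iff)
  qed (rule continuous_on_subset[OF cont sub[OF that(1,2)]])
  moreover have "f x < f y" if "x \<in> D" "y \<in> D" "m \<le> x" "x < y" for x y
  proof (rule DERIV_pos_imp_increasing_open[OF \<open>x < y\<close>])
    fix z assume z: "x < z" "z < y"
    then have "z \<in> D" using sub[OF that(1,2)] by auto
    then show "\<exists>d. DERIV f z :> d \<and> d > 0"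
      using der[of z] q[of z] z that by (intro exI[of _ "(z - m) * q z"]) auto
  qed (rule continuous_on_subset[OF cont sub[OF that(1,2)]])
  ultimately show ?thesis
    unfolding valley_def using assms(6,7) D cont by blast
qed

lemma valley_min_less:
  assumes "valley D f m" "x \<in> D" "x \<noteq> m"
  shows "f m < f x"
  using assms unfolding valley_def by (metis linorder_neqE_linordered_idom order_refl)

text \<open>On either side of the minimum the values are ordered like the distances to the minimum, so that
the two branches can be treated at once.\<close>

lemma valley_less_iff:
  assumes v: "valley D f m" and "x \<in> D" "y \<in> D" and s: "sgn (x - m) = sgn (y - m)"
  shows "f x < f y \<longleftrightarrow> \<bar>x - m\<bar> < \<bar>y - m\<bar>"
proof -
  have less: "f a < f b" if "a \<in> D" "b \<in> D" "sgn (a - m) = sgn (b - m)" "\<bar>a - m\<bar> < \<bar>b - m\<bar>" for a b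
  proof (cases "a \<le> m")
    case True
    then have "b < a" using that by (auto simp: sgn_if split: if_splits)
    then show ?thesis using True v that unfolding valley_def by blast
  next
    case False
    then have "a < b" using that by (auto simp: sgn_if split: if_splits)
    then show ?thesis using False v that unfolding valley_def by (metis less_eq_real_def not_le)
  qed
  have eq: "x = y" if "\<bar>x - m\<bar> = \<bar>y - m\<bar>"
    using that s by (auto simp: sgn_if split: if_splits)
  show ?thesis
    using less[of x y] less[of y x] eq assms by (metis less_irrefl less_trans linorder_less_linear)
qed

lemma valley_inj_on_side:
  assumes "valley D f m" and "x \<in> D" "y \<in> D" and "sgn (x - m) = sgn (y - m)" "f x = f y"
  shows "x = y"
  using valley_less_iff[OF assms(1-4)] valley_less_iff[OF assms(1,3,2) assms(4)[symmetric]] assms(4,5)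
  by (auto simp: sgn_if split: if_splits)

lemma valley_solve:
  assumes v: "valley D f m" and y: "f m < y" and s: "s = 1 \<or> s = -1"
  obtains x where "x \<in> D" "sgn (x - m) = s" "f x = y"
proof -
  have cont: "continuous_on {a..b} f" if "a \<in> D" "b \<in> D" for a b
    using v that unfolding valley_def is_interval_1
    by (meson atLeastAtMost_iff continuous_on_subset subsetI)
  have inD: "x \<in> D" if "a \<in> D" "b \<in> D" "a \<le> x" "x \<le> b" for a b x
    using v that unfolding valley_def is_interval_1 by blast
  have m: "m \<in> D" using v unfolding valley_def by blast
  have "\<exists>x\<in>D. sgn (x - m) = s \<and> f x = y" using s
  proof
    assume "s = 1"
    obtain b where b: "b \<in> D" "m < b" "y < f b" using v unfolding valley_def by blast
    obtain x where "m \<le> x" "x \<le> b" "f x = y"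
      using IVT'[of f m y b] b y cont[OF m b(1)] by auto
    moreover have "x \<noteq> m" using calculation y by auto
    ultimately show ?thesis
      using inD[OF m b(1)] \<open>s = 1\<close> by (intro bexI[of _ x]) auto
  next
    assume "s = -1"
    obtain b where b: "b \<in> D" "b < m" "y < f b" using v unfolding valley_def by blast
    obtain x where "b \<le> x" "x \<le> m" "f x = y"
      using IVT2'[of f m y b] b y cont[OF b(1) m] by auto
    moreover have "x \<noteq> m" using calculation y by auto
    ultimately show ?thesis
      using inD[OF b(1) m] \<open>s = -1\<close> by (intro bexI[of _ x]) auto
  qed
  then show thesis using that by blast
qed

lemma valley_level_set:
  assumes v: "valley D f m" and y: "f m \<le> y"
  obtains lo hi where "lo \<in> D" "hi \<in> D" "lo \<le> m" "m \<le> hi" "{x \<in> D. f x = y} = {lo, hi}"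
    "\<And>x. x \<in> D \<Longrightarrow> y < f x \<longleftrightarrow> x < lo \<or> hi < x" "f m < y \<Longrightarrow> lo < hi"
proof (cases "f m = y")
  case True
  have m: "m \<in> D" using v unfolding valley_def by blast
  have "{x \<in> D. f x = y} = {m, m}"
    using valley_min_less[OF v] m True by fastforce
  moreover have "y < f x \<longleftrightarrow> x < m \<or> m < x" if "x \<in> D" for x
    using valley_min_less[OF v that] True by (cases "x = m") auto
  ultimately show thesis using that[of m m] m True by auto
next
  case False
  then have y': "f m < y" using y by simp
  obtain lo where lo: "lo \<in> D" "sgn (lo - m) = -1" "f lo = y"
    using valley_solve[OF v y'] by metis
  obtain hi where hi: "hi \<in> D" "sgn (hi - m) = 1" "f hi = y"
    using valley_solve[OF v y'] by metis
  have lom: "lo < m" "m < hi" using lo hi by (auto simp: sgn_if split: if_splits)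
  have key: "(y < f x \<longleftrightarrow> x < lo \<or> hi < x) \<and> (f x = y \<longleftrightarrow> x = lo \<or> x = hi)" if x: "x \<in> D" for x
  proof -
    consider "sgn (x - m) = -1" | "x = m" | "sgn (x - m) = 1"
      by (cases x m rule: linorder_cases) auto
    then show ?thesis
    proof cases
      case 1
      then have xm: "x < m" by (auto simp: sgn_if split: if_splits)
      have "f lo < f x \<longleftrightarrow> \<bar>lo - m\<bar> < \<bar>x - m\<bar>"
        using 1 lo x by (intro valley_less_iff[OF v]) auto
      moreover have "f x = y \<longleftrightarrow> x = lo"
        using valley_inj_on_side[OF v lo(1) x] 1 lo by metis
      ultimately show ?thesis using lo(3) xm lom by (simp add: abs_if)
    next
      case 2
      then show ?thesis using y' lom by auto
    next
      case 3
      then have xm: "x > m" by (auto simp: sgn_if split: if_splits)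
      have "f hi < f x \<longleftrightarrow> \<bar>hi - m\<bar> < \<bar>x - m\<bar>"
        using 3 hi x by (intro valley_less_iff[OF v]) auto
      moreover have "f x = y \<longleftrightarrow> x = hi"
        using valley_inj_on_side[OF v hi(1) x] 3 hi by metis
      ultimately show ?thesis using hi(3) xm lom by (simp add: abs_if)
    qed
  qed
  show thesis
    by (rule that[of lo hi]) (use lo hi lom key y' in auto)
qed

text \<open>Near the minimal value the only points on a branch are those near \<open>m\<close>. This gives the limit of the
velocity at a sonic point, where the branch inverse has no derivative.\<close>

lemma valley_inverse_tendsto:
  assumes v: "valley D f m" and s: "s = 1 \<or> s = -1"
    and u: "eventually (\<lambda>t. u t \<in> D \<and> sgn (u t - m) = s) F" and lim: "((\<lambda>t. f (u t)) \<longlongrightarrow> f m) F"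
  shows "(u \<longlongrightarrow> m) F"
proof (rule tendstoI)
  fix e :: real assume e: "e > 0"
  have "open D" "m \<in> D" using v unfolding valley_def by auto
  then obtain d where d: "d > 0" "ball m d \<subseteq> D" by (meson openE)
  define x where "x = m + s * (min d e / 2)"
  have x: "x \<in> D" "sgn (x - m) = s" "\<bar>x - m\<bar> < e"
  proof -
    have "dist m x < d" using s d e by (auto simp: x_def dist_real_def)
    then show "x \<in> D" using d by auto
    show "sgn (x - m) = s" "\<bar>x - m\<bar> < e" using s d e by (auto simp: x_def sgn_mult)
  qed
  then have "f m < f x" using valley_min_less[OF v x(1)] s by (cases "x = m") auto
  then have "eventually (\<lambda>t. f (u t) < f x) F" using lim by (simp add: order_tendsto_iff)
  then show "eventually (\<lambda>t. dist (u t) m < e) F"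
    using u
  proof eventually_elim
    case (elim t)
    then show ?case using valley_less_iff[OF v, of "u t" x] x by (auto simp: dist_real_def)
  qed
qed

text \<open>A branch is an open set on which the function is injective with non-vanishing derivative, so the
inverse function theorem applies to its inverse.\<close>

lemma valley_local_inverse:
  assumes v: "valley D f m" and s: "s = 1 \<or> s = -1"
    and y: "f m < y"
    and der: "\<And>x. x \<in> D \<Longrightarrow> (f has_real_derivative f' x) (at x)" and nz: "\<And>x. x \<in> D \<Longrightarrow> x \<noteq> m \<Longrightarrow> f' x \<noteq> 0"
  defines "B \<equiv> {x \<in> D. sgn (x - m) = s}"
  defines "g \<equiv> the_inv_into B f"
  shows "g y \<in> B" "f (g y) = y" "(g has_real_derivative inverse (f' (g y))) (at y)"
proof -
  have inj: "inj_on f B"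
    unfolding inj_on_def B_def using valley_inj_on_side[OF v] by auto
  obtain x where x: "x \<in> B" "f x = y"
    using valley_solve[OF v y s] unfolding B_def by blast
  have gx: "g y = x" unfolding g_def using the_inv_into_f_f[OF inj x(1)] x by simp
  show "g y \<in> B" "f (g y) = y" using gx x by auto
  have "B = D \<inter> {m<..} \<or> B = D \<inter> {..<m}"
    using s unfolding B_def by (auto simp: sgn_if split: if_splits)
  then have op: "open B" using v unfolding valley_def by auto
  have cont: "continuous_on B f"
    by (rule continuous_on_subset[of D]) (use v in \<open>auto simp: valley_def B_def\<close>)
  have "(g has_derivative (*) (inverse (f' x))) (at (f x))"
  proof (rule has_derivative_inverse_strong[OF op x(1) cont])
    show "(f has_derivative (*) (f' x)) (at x)"
      using der x(1) by (simp add: B_def has_field_derivative_def)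
    show "g (f z) = z" if "z \<in> B" for z
      unfolding g_def by (rule the_inv_into_f_f[OF inj that])
    have "x \<noteq> m" using x(1) s by (auto simp: B_def)
    then show "(*) (f' x) \<circ> (*) (inverse (f' x)) = id"
      using nz x(1) by (auto simp: B_def fun_eq_iff)
  qed
  then show "(g has_real_derivative inverse (f' (g y))) (at y)" using gx x by (simp add: has_field_derivative_def)
qed

section \<open>Smoothness of solutions of rational differential equations\<close>

text \<open>If \<open>u' = R(x, u)\<close> on \<open>I\<close> with \<open>R\<close> rational and without poles, then the expressions rational in \<open>x\<close>
and \<open>u\<close> are mapped to each other by differentiation, and such a class consists of smooth
functions. Membership in the class demands a non-vanishing denominator on \<open>I\<close> only; off \<open>I\<close> the
division by zero is harmless, because equalities are used on \<open>I\<close> alone.\<close>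

inductive_set rational_in :: "real set \<Rightarrow> (real \<Rightarrow> real) \<Rightarrow> (real \<Rightarrow> real) set" for I u where
  unknown: "u \<in> rational_in I u"
| ident: "(\<lambda>x. x) \<in> rational_in I u"
| const: "(\<lambda>x. c) \<in> rational_in I u"
| add: "f \<in> rational_in I u \<Longrightarrow> g \<in> rational_in I u \<Longrightarrow> (\<lambda>x. f x + g x) \<in> rational_in I u"
| mult: "f \<in> rational_in I u \<Longrightarrow> g \<in> rational_in I u \<Longrightarrow> (\<lambda>x. f x * g x) \<in> rational_in I u"
| inverse: "f \<in> rational_in I u \<Longrightarrow> (\<And>x. x \<in> I \<Longrightarrow> f x \<noteq> 0) \<Longrightarrow> (\<lambda>x. inverse (f x)) \<in> rational_in I u"

lemma rational_in_diff:
  "f \<in> rational_in I u \<Longrightarrow> g \<in> rational_in I u \<Longrightarrow> (\<lambda>x. f x - g x) \<in> rational_in I u"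
  using rational_in.add[OF _ rational_in.mult[OF rational_in.const[of "-1"]], of f I u g] by simp

lemma rational_in_divide:
  "f \<in> rational_in I u \<Longrightarrow> g \<in> rational_in I u \<Longrightarrow> (\<And>x. x \<in> I \<Longrightarrow> g x \<noteq> 0)
    \<Longrightarrow> (\<lambda>x. f x / g x) \<in> rational_in I u"
  using rational_in.mult[OF _ rational_in.inverse, of f I u g] by (simp add: divide_inverse)

lemma rational_in_power: "f \<in> rational_in I u \<Longrightarrow> (\<lambda>x. f x ^ n) \<in> rational_in I u"
  by (induction n) (auto intro: rational_in.const rational_in.mult)

lemmas rational_in_intros = rational_in.intros rational_in_diff rational_in_divide rational_in_power

lemma rational_in_derivative:
  assumes u: "u' \<in> rational_in I u" "\<And>x. x \<in> I \<Longrightarrow> (u has_real_derivative u' x) (at x)"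
    and f: "f \<in> rational_in I u"
  shows "\<exists>f' \<in> rational_in I u. \<forall>x\<in>I. (f has_real_derivative f' x) (at x)"
  using f
proof induction
  case unknown
  then show ?case using u by blast
next
  case ident
  then show ?case by (intro bexI[of _ "\<lambda>x. 1"]) (auto intro: rational_in.const)
next
  case (const c)
  then show ?case by (intro bexI[of _ "\<lambda>x. 0"]) (auto intro: rational_in.const)
next
  case (add f g)
  then obtain f' g' where "f' \<in> rational_in I u" "g' \<in> rational_in I u"
    "\<forall>x\<in>I. (f has_real_derivative f' x) (at x)" "\<forall>x\<in>I. (g has_real_derivative g' x) (at x)"
    by blast
  then show ?case
    by (intro bexI[of _ "\<lambda>x. f' x + g' x"]) (auto intro: rational_in.add DERIV_add)
next
  case (mult f g)
  then obtain f' g' where *: "f' \<in> rational_in I u" "g' \<in> rational_in I u"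
    "\<forall>x\<in>I. (f has_real_derivative f' x) (at x)" "\<forall>x\<in>I. (g has_real_derivative g' x) (at x)"
    by blast
  show ?case
    by (intro bexI[of _ "\<lambda>x. f' x * g x + g' x * f x"] ballI DERIV_mult)
      (use * mult in \<open>auto intro!: rational_in.add rational_in.mult\<close>)
next
  case (inverse f)
  then obtain f' where *: "f' \<in> rational_in I u" "\<forall>x\<in>I. (f has_real_derivative f' x) (at x)"
    by blast
  have "(\<lambda>x. (-1) * (inverse (f x) * f' x * inverse (f x))) \<in> rational_in I u"
    using * inverse by (intro rational_in.mult rational_in.const rational_in.inverse) auto
  moreover have "\<forall>x\<in>I. ((\<lambda>x. inverse (f x)) has_real_derivative
      (-1) * (inverse (f x) * f' x * inverse (f x))) (at x)"
    using * inverse by (auto intro!: derivative_eq_intros)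
  ultimately show ?case
    by (intro bexI[of _ "\<lambda>x. (-1) * (inverse (f x) * f' x * inverse (f x))"])
qed

text \<open>The iterated derivative sees a function only up to equality on the open set, so the induction is over
all functions that agree on \<open>I\<close> with a member of the class.\<close>

lemma rational_in_smooth:
  assumes I: "open I"
    and u: "u' \<in> rational_in I u" "\<And>x. x \<in> I \<Longrightarrow> (u has_real_derivative u' x) (at x)"
    and f: "f \<in> rational_in I u"
  shows "smooth_on_open f I"
proof -
  have "\<forall>r\<in>I. (deriv ^^ n) h field_differentiable (at r)"
    if "g \<in> rational_in I u" "\<forall>x\<in>I. h x = g x" for n g h
    using that
  proof (induction n arbitrary: g h)
    have der: "\<exists>g' \<in> rational_in I u. \<forall>x\<in>I. (h has_real_derivative g' x) (at x)"
      if g: "g \<in> rational_in I u" "\<forall>x\<in>I. h x = g x" for g h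
    proof -
      obtain g' where "g' \<in> rational_in I u" "\<forall>x\<in>I. (g has_real_derivative g' x) (at x)"
        using rational_in_derivative[OF u g(1)] by blast
      then show ?thesis
        using has_field_derivative_transform_within_open[OF _ I, of g _ _ h] g(2) by metis
    qed
    {
      case 0
      then show ?case using der[OF 0] by (auto simp: field_differentiable_def)
    next
      case (Suc n)
      obtain g' where "g' \<in> rational_in I u" "\<forall>x\<in>I. (h has_real_derivative g' x) (at x)"
        using der[OF Suc.prems] by blast
      then have "\<forall>r\<in>I. (deriv ^^ n) (deriv h) field_differentiable (at r)"
        by (intro Suc.IH[of g']) (auto simp: DERIV_imp_deriv)
      then show ?case by (simp add: funpow_swap1)
    }
  qed
  then show ?thesis using f unfolding smooth_on_open_def by blast
qed


section \<open>The two potentials of the steady Euler system\<close>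

locale schwarzschild_fluid =
  fixes \<epsilon> k M :: real
  assumes eps: "\<epsilon> > 0" and k_pos: "0 < k" and k_light: "k < 1 / \<epsilon>" and M_pos: "M > 0"
begin

text \<open>
The number \<open>a\<close> is the squared ratio of sound speed and light speed, and \<open>b = (1 - \<kappa>)/\<kappa>\<close> (see
\<open>kappa_eq\<close> below). Rational functions of \<open>\<kappa>\<close> become simple in \<open>a\<close>.
\<close>

definition a :: real where "a = \<epsilon>^2 * k^2"
definition b :: real where "b = 2 * a / (1 - a)"
definition r_crit :: real where "r_crit = (1 + 3 * a) / (2 * a) * M"

text \<open>These are antiderivatives, up to the common factor \<open>2 / (1 - a)\<close>, of the two sides of
\<open>\<epsilon>\<^sup>2(v\<^sup>2 - k\<^sup>2) / (v (1 - \<epsilon>\<^sup>2v\<^sup>2)) dv = (2ar - (1 + 3a)M) / (r (r - 2M)) dr\<close>.\<close>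

definition fluid_potential :: "real \<Rightarrow> real" where
  "fluid_potential v = - b * ln v - ln (1 - \<epsilon>^2 * v^2)"

definition geometric_potential :: "real \<Rightarrow> real" where
  "geometric_potential r = (1 + 2 * b) * ln r - ln (r - 2 * M)"

lemma lorentz_pos: "0 \<le> v \<Longrightarrow> v < 1 / \<epsilon> \<Longrightarrow> 0 < 1 - \<epsilon>^2 * v^2"
proof -
  assume "0 \<le> v" "v < 1 / \<epsilon>"
  then have "0 \<le> \<epsilon> * v" "\<epsilon> * v < 1" using eps by (auto simp: field_simps)
  then have "(\<epsilon> * v)^2 < 1" by (simp add: power_less_one_iff abs_square_less_1)
  then show ?thesis by (simp add: power_mult_distrib)
qed

lemma a_bounds: "0 < a" "a < 1"
  using eps k_pos lorentz_pos[of k] k_light by (auto simp: a_def)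

lemma b_pos: "0 < b"
  using a_bounds by (simp add: b_def)

lemma kappa_eq:
  shows "(1 - kappa \<epsilon> k) / kappa \<epsilon> k = b" "kappa \<epsilon> k / (1 - kappa \<epsilon> k) = 1 / b"
    "(2 - kappa \<epsilon> k) / (1 - kappa \<epsilon> k) = (1 + 3 * a) / (2 * a)"
    "2 * (2 - kappa \<epsilon> k) / (1 + kappa \<epsilon> k) = 1 + 3 * a"
proof -
  have kap: "kappa \<epsilon> k = (1 - a) / (1 + a)" by (simp add: kappa_def a_def)
  have e: "1 - kappa \<epsilon> k = 2 * a / (1 + a)" "2 - kappa \<epsilon> k = (1 + 3 * a) / (1 + a)"
    "1 + kappa \<epsilon> k = 2 / (1 + a)"
    using a_bounds unfolding kap by (auto simp: field_simps)
  show "(1 - kappa \<epsilon> k) / kappa \<epsilon> k = b" "kappa \<epsilon> k / (1 - kappa \<epsilon> k) = 1 / b"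
    unfolding e unfolding kap b_def using a_bounds by simp_all
  show "(2 - kappa \<epsilon> k) / (1 - kappa \<epsilon> k) = (1 + 3 * a) / (2 * a)"
    "2 * (2 - kappa \<epsilon> k) / (1 + kappa \<epsilon> k) = 1 + 3 * a"
    unfolding e using a_bounds by simp_all
qed

lemma r_crit_outside: "2 * M < r_crit"
proof -
  have "r_crit - 2 * M = M * (1 - a) / (2 * a)"
    using a_bounds by (simp add: r_crit_def field_simps)
  moreover have "M * (1 - a) / (2 * a) > 0" using a_bounds M_pos by simp
  ultimately show ?thesis by linarith
qed

lemma DERIV_fluid_potential:
  assumes "0 < v" "v < 1 / \<epsilon>"
  shows "(fluid_potential has_real_derivative
    2 / (1 - a) * (\<epsilon>^2 * (v^2 - k^2) / (v * (1 - \<epsilon>^2 * v^2)))) (at v)"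
proof -
  have W: "1 - \<epsilon>^2 * v^2 > 0" using lorentz_pos assms by simp
  have "(fluid_potential has_real_derivative - b / v + 2 * \<epsilon>^2 * v / (1 - \<epsilon>^2 * v^2)) (at v)"
    unfolding fluid_potential_def using W assms
    by (auto intro!: derivative_eq_intros simp: divide_simps)
  moreover have "- b / v + 2 * \<epsilon>^2 * v / (1 - \<epsilon>^2 * v^2)
      = 2 / (1 - a) * (\<epsilon>^2 * (v^2 - k^2) / (v * (1 - \<epsilon>^2 * v^2)))"
  proof -
    have "- b / v + 2 * \<epsilon>^2 * v / (1 - \<epsilon>^2 * v^2)
      = (2 * \<epsilon>^2 * v^2 - b * (1 - \<epsilon>^2 * v^2)) / (v * (1 - \<epsilon>^2 * v^2))"
      using W assms by (simp add: field_simps power2_eq_square)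
    also have "2 * \<epsilon>^2 * v^2 - b * (1 - \<epsilon>^2 * v^2) = 2 / (1 - a) * (\<epsilon>^2 * v^2 - a)"
      using a_bounds by (simp add: b_def field_simps)
    also have "\<epsilon>^2 * v^2 - a = \<epsilon>^2 * (v^2 - k^2)" by (simp add: a_def algebra_simps)
    finally show ?thesis by simp
  qed
  ultimately show ?thesis by simp
qed

lemma DERIV_geometric_potential:
  assumes "2 * M < r"
  shows "(geometric_potential has_real_derivative
    2 / (1 - a) * ((2 * a * r - (1 + 3 * a) * M) / (r * (r - 2 * M)))) (at r)"
proof -
  have r: "r > 0" "r - 2 * M > 0" using assms M_pos by auto
  have "(geometric_potential has_real_derivative (1 + 2 * b) / r - 1 / (r - 2 * M)) (at r)"
    unfolding geometric_potential_def using r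
    by (auto intro!: derivative_eq_intros simp: divide_simps)
  moreover have "(1 + 2 * b) / r - 1 / (r - 2 * M)
    = 2 / (1 - a) * ((2 * a * r - (1 + 3 * a) * M) / (r * (r - 2 * M)))"
  proof -
    have "(1 + 2 * b) / r - 1 / (r - 2 * M) = (2 * b * r - (1 + 2 * b) * 2 * M) / (r * (r - 2 * M))"
      using r by (simp add: field_simps)
    also have "2 * b * r - (1 + 2 * b) * 2 * M = 2 / (1 - a) * (2 * a * r - (1 + 3 * a) * M)"
    proof -
      have "b * (1 - a) = 2 * a" using a_bounds by (simp add: b_def)
      then have "(2 * b * r - (1 + 2 * b) * 2 * M) * (1 - a) = 2 * (2 * a * r - (1 + 3 * a) * M)"
        by algebra
      then show ?thesis using a_bounds by (simp add: eq_divide_eq)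
    qed
    finally show ?thesis by simp
  qed
  ultimately show ?thesis by simp
qed

lemma valley_fluid_potential: "valley {0<..<1 / \<epsilon>} fluid_potential k"
proof (rule valleyI_derivative)
  define q where "q v = 2 / (1 - a) * (\<epsilon>^2 * (v + k) / (v * (1 - \<epsilon>^2 * v^2)))" for v
  fix v assume v: "v \<in> {0<..<1 / \<epsilon>}"
  then have "(fluid_potential has_real_derivative
      2 / (1 - a) * (\<epsilon>^2 * (v^2 - k^2) / (v * (1 - \<epsilon>^2 * v^2)))) (at v)"
    by (intro DERIV_fluid_potential) auto
  moreover have "v^2 - k^2 = (v - k) * (v + k)" by (simp add: power2_eq_square algebra_simps)
  ultimately show "(fluid_potential has_real_derivative (v - k) * q v) (at v)"
    by (simp add: q_def mult_ac)
  show "q v > 0"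
    unfolding q_def using v k_pos eps a_bounds lorentz_pos[of v]
    by (intro mult_pos_pos divide_pos_pos add_pos_pos) auto
next
  fix y
  define x where "x = min (k / 2) (exp (- (\<bar>y\<bar> + 1) / b))"
  have x: "0 < x" "x < k" "x \<le> exp (- (\<bar>y\<bar> + 1) / b)"
    using k_pos by (auto simp: x_def min_less_iff_disj)
  have "ln x \<le> - (\<bar>y\<bar> + 1) / b"
    using x by (metis exp_gt_zero ln_exp ln_mono)
  then have "b * ln x \<le> - (\<bar>y\<bar> + 1)"
    using b_pos by (simp add: field_simps)
  moreover have "ln (1 - \<epsilon>^2 * x^2) \<le> 0"
    using lorentz_pos[of x] x k_light by (intro ln_le_zero_iff[THEN iffD2]) auto
  ultimately have "y < fluid_potential x"
    unfolding fluid_potential_def by linarith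
  then show "\<exists>x\<in>{0<..<1 / \<epsilon>}. x < k \<and> y < fluid_potential x"
    using x k_light by (intro bexI[of _ x]) auto
next
  fix y
  \<comment> \<open>Towards the light speed \<open>- ln (1 - \<epsilon>\<^sup>2x\<^sup>2)\<close> takes over; \<open>t\<close> is the value of \<open>1 - \<epsilon>\<^sup>2x\<^sup>2\<close>.\<close>
  define t where "t = min ((1 - a) / 2) (exp (- (\<bar>y\<bar> + b * \<bar>ln \<epsilon>\<bar> + 1)))"
  define x where "x = sqrt (1 - t) / \<epsilon>"
  have t: "0 < t" "t < 1 - a" "t \<le> exp (- (\<bar>y\<bar> + b * \<bar>ln \<epsilon>\<bar> + 1))"
    using a_bounds by (auto simp: t_def min_less_iff_disj)
  then have t1: "t < 1" using a_bounds by linarith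
  have ex: "\<epsilon>^2 * x^2 = 1 - t" using t1 eps by (simp add: x_def power_divide)
  have x1: "x < 1 / \<epsilon>" using t eps t1 by (simp add: x_def divide_strict_right_mono)
  have "\<epsilon> * k = sqrt a" using eps k_pos by (simp add: a_def real_sqrt_mult)
  also have "\<dots> < sqrt (1 - t)" using t by simp
  finally have xk: "k < x" using eps by (simp add: x_def field_simps)
  have "ln x \<le> ln (1 / \<epsilon>)" using x1 xk k_pos by (intro ln_mono) auto
  then have "ln x \<le> \<bar>ln \<epsilon>\<bar>" using eps by (simp add: ln_div)
  then have "b * ln x \<le> b * \<bar>ln \<epsilon>\<bar>" using b_pos by simp
  moreover have "ln (1 - \<epsilon>^2 * x^2) \<le> - (\<bar>y\<bar> + b * \<bar>ln \<epsilon>\<bar> + 1)"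
    unfolding ex using t by (metis diff_diff_eq2 add_diff_cancel_left' exp_gt_zero ln_exp ln_mono)
  ultimately have "y < fluid_potential x"
    unfolding fluid_potential_def by linarith
  then show "\<exists>x\<in>{0<..<1 / \<epsilon>}. k < x \<and> y < fluid_potential x"
    using x1 xk k_pos by (intro bexI[of _ x]) auto
qed (use k_pos k_light in \<open>auto simp: is_interval_1\<close>)

lemma valley_geometric_potential: "valley {2 * M<..} geometric_potential r_crit"
proof (rule valleyI_derivative)
  define q where "q r = 2 / (1 - a) * (2 * a / (r * (r - 2 * M)))" for r
  fix r assume r: "r \<in> {2 * M<..}"
  have "2 * a * r - (1 + 3 * a) * M = 2 * a * (r - r_crit)"
    using a_bounds by (simp add: r_crit_def field_simps)
  then have "2 / (1 - a) * ((2 * a * r - (1 + 3 * a) * M) / (r * (r - 2 * M))) = (r - r_crit) * q r"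
    unfolding q_def by (simp only: times_divide_eq_left times_divide_eq_right mult_ac)
  then show "(geometric_potential has_real_derivative (r - r_crit) * q r) (at r)"
    using DERIV_geometric_potential[of r] r by simp
  show "q r > 0"
    unfolding q_def using r M_pos a_bounds by auto
next
  fix y
  define t where "t = min ((r_crit - 2 * M) / 2) (exp (- (\<bar>y\<bar> + (1 + 2 * b) * \<bar>ln (2 * M)\<bar> + 1)))"
  define x where "x = 2 * M + t"
  have t: "0 < t" "t < r_crit - 2 * M" "t \<le> exp (- (\<bar>y\<bar> + (1 + 2 * b) * \<bar>ln (2 * M)\<bar> + 1))"
    using r_crit_outside by (auto simp: t_def min_less_iff_disj)
  have "ln (2 * M) \<le> ln x" using t M_pos by (intro ln_mono) (auto simp: x_def)
  then have "(1 + 2 * b) * (- \<bar>ln (2 * M)\<bar>) \<le> (1 + 2 * b) * ln x"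
    using b_pos by (intro mult_left_mono) auto
  moreover have "ln (x - 2 * M) \<le> - (\<bar>y\<bar> + (1 + 2 * b) * \<bar>ln (2 * M)\<bar> + 1)"
    unfolding x_def using t by (metis add_diff_cancel_left' exp_gt_zero ln_exp ln_mono)
  ultimately have "y < geometric_potential x"
    unfolding geometric_potential_def by linarith
  then show "\<exists>x\<in>{2 * M<..}. x < r_crit \<and> y < geometric_potential x"
    using t by (intro bexI[of _ x]) (auto simp: x_def)
next
  fix y
  define x where "x = max (r_crit + 1) (exp ((\<bar>y\<bar> + 1) / (2 * b)))"
  have x: "r_crit < x" "exp ((\<bar>y\<bar> + 1) / (2 * b)) \<le> x" by (auto simp: x_def)
  have "(\<bar>y\<bar> + 1) / (2 * b) \<le> ln x"
    using x by (metis exp_gt_zero ln_exp ln_mono)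
  then have "\<bar>y\<bar> + 1 \<le> 2 * b * ln x"
    using b_pos by (simp add: field_simps)
  moreover have "ln (x - 2 * M) \<le> ln x"
    using x r_crit_outside M_pos by (intro ln_mono) auto
  ultimately have "y < geometric_potential x"
    unfolding geometric_potential_def by (simp add: algebra_simps)
  then show "\<exists>x\<in>{2 * M<..}. r_crit < x \<and> y < geometric_potential x"
    using x r_crit_outside by (intro bexI[of _ x]) auto
qed (use r_crit_outside in \<open>auto simp: is_interval_1\<close>)

text \<open>Along a moving solution \<open>fluid_potential v - fluid_potential k = geometric_potential r - sonic_level\<close>, and the
left-hand side is non-negative and vanishes at the sound speed only.\<close>

definition sonic_level :: "real \<Rightarrow> real \<Rightarrow> real" where
  "sonic_level r0 v0 = geometric_potential r0 - fluid_potential v0 + fluid_potential k"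

lemma P_sonic_eq:
  assumes "2 * M < r0" "0 < v0" "v0 < 1 / \<epsilon>"
  shows "P_sonic \<epsilon> k M r0 v0 = ereal ((geometric_potential r_crit - sonic_level r0 v0) / b)"
proof -
  have W: "1 - \<epsilon>^2 * v0^2 > 0" using lorentz_pos assms by simp
  have r0: "r0 > 0" "r0 - 2 * M > 0" using assms M_pos by auto
  have rc: "r_crit > 0" using r_crit_outside M_pos by linarith
  have rc2: "r_crit - 2 * M = r_crit * (1 - a) / (1 + 3 * a)"
  proof -
    have "r_crit - 2 * M = M * (1 - a) / (2 * a)"
      using a_bounds by (simp add: r_crit_def field_simps)
    also have "\<dots> = r_crit * (1 - a) / (1 + 3 * a)"
      using a_bounds by (simp add: r_crit_def)
    finally show ?thesis .
  qed
  have 1: "ln ((1 + 3 * a)^2 / (2 * a)^2 * (M^2 * k / (r0^2 * v0)))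
    = 2 * ln r_crit + ln k - 2 * ln r0 - ln v0"
  proof -
    have "(1 + 3 * a)^2 / (2 * a)^2 * (M^2 * k / (r0^2 * v0)) = r_crit^2 * k / (r0^2 * v0)"
      by (simp add: r_crit_def power_mult_distrib power_divide)
    also have "ln \<dots> = 2 * ln r_crit + ln k - 2 * ln r0 - ln v0"
      using rc r0 k_pos assms by (simp add: ln_div ln_mult ln_realpow)
    finally show ?thesis .
  qed
  have 2: "ln ((1 + 3 * a) * ((r0 - 2 * M) / (r0 * (1 - \<epsilon>^2 * v0^2))))
    = ln (1 + 3 * a) + ln (r0 - 2 * M) - ln r0 - ln (1 - \<epsilon>^2 * v0^2)"
    using r0 W a_bounds by (simp add: ln_div ln_mult)
  have 3: "ln (r_crit - 2 * M) = ln r_crit + ln (1 - a) - ln (1 + 3 * a)"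
    unfolding rc2 using rc a_bounds by (simp add: ln_div ln_mult)
  have "geometric_potential r_crit - sonic_level r0 v0
    = b * (2 * ln r_crit + ln k - 2 * ln r0 - ln v0)
      + (ln (1 + 3 * a) + ln (r0 - 2 * M) - ln r0 - ln (1 - \<epsilon>^2 * v0^2))"
    unfolding sonic_level_def geometric_potential_def fluid_potential_def 3 a_def[symmetric]
    by (simp add: algebra_simps)
  then have "(geometric_potential r_crit - sonic_level r0 v0) / b
    = (2 * ln r_crit + ln k - 2 * ln r0 - ln v0)
      + 1 / b * (ln (1 + 3 * a) + ln (r0 - 2 * M) - ln r0 - ln (1 - \<epsilon>^2 * v0^2))"
    using b_pos by (simp add: add_divide_distrib)
  then show ?thesis
    using assms unfolding P_sonic_def Let_def power_divide[symmetric] kappa_eq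
    unfolding power_divide 1 2 by simp
qed

lemma sonic_points_eq:
  assumes "2 * M < r0" "0 < v0" "v0 < 1 / \<epsilon>"
  shows "sonic_points \<epsilon> k M r0 v0 = {r \<in> {2 * M<..}. geometric_potential r = sonic_level r0 v0}"
proof -
  have W: "1 - \<epsilon>^2 * v0^2 > 0" "1 - a > 0" using lorentz_pos assms a_bounds by auto
  have "ln ((1 - \<epsilon>^2 * v0^2) / (1 - \<epsilon>^2 * k^2)) + b * ln (v0 / k)
      = b * ln (r^2 / r0^2) + ln (r * (r0 - 2 * M) / (r0 * (r - 2 * M)))
    \<longleftrightarrow> geometric_potential r = sonic_level r0 v0" if r: "2 * M < r" for r
  proof -
    have pos: "r > 0" "r - 2 * M > 0" "r0 > 0" "r0 - 2 * M > 0"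
      using assms r M_pos by auto
    have e: "ln ((1 - \<epsilon>^2 * v0^2) / (1 - a)) = ln (1 - \<epsilon>^2 * v0^2) - ln (1 - a)"
      "ln (v0 / k) = ln v0 - ln k" "ln (r^2 / r0^2) = 2 * ln r - 2 * ln r0"
      "ln (r * (r0 - 2 * M) / (r0 * (r - 2 * M))) = ln r + ln (r0 - 2 * M) - ln r0 - ln (r - 2 * M)"
      using pos W assms k_pos by (simp_all add: ln_div ln_mult ln_realpow)
    show ?thesis
      unfolding sonic_level_def geometric_potential_def fluid_potential_def a_def[symmetric] e
      by (auto simp: algebra_simps)
  qed
  then show ?thesis unfolding sonic_points_def Let_def kappa_eq by auto
qed

section \<open>First integrals\<close>

text \<open>The momentum is the mass flux times \<open>Q = (1 - 2M/r) (v + k\<^sup>2/v) / (1 + a)\<close>. As the flux is conserved,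
the density drops out of its derivative, and what is left of the momentum equation is the separable
equation for \<open>v\<close>. The denominators \<open>v\<^sup>2 - k\<^sup>2\<close> are avoided, so that the equivalence also holds at sonic
points.\<close>

lemma momentum_balance_iff:
  fixes \<rho> v :: "real \<Rightarrow> real"
  assumes I: "open I" "I \<subseteq> {2 * M<..}" "r \<in> I"
    and v: "\<And>s. s \<in> I \<Longrightarrow> 0 < v s \<and> v s < 1 / \<epsilon>" and \<rho>: "\<rho> r > 0"
    and dv: "(v has_real_derivative v') (at r)"
    and flux: "((\<lambda>s. s * (s - 2 * M) * ((1 + \<epsilon>^2 * k^2) / (1 - \<epsilon>^2 * (v s)^2)) * \<rho> s * v s)
      has_real_derivative 0) (at r)"
  shows "((\<lambda>s. (s - 2 * M)^2 * (((v s)^2 + k^2) / (1 - \<epsilon>^2 * (v s)^2)) * \<rho> s)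
      has_real_derivative
        (M / r * ((r - 2 * M) / (1 - \<epsilon>^2 * (v r)^2)) *
           (3 * \<rho> r * (v r)^2 + 3 * k^2 * \<rho> r - \<rho> r / \<epsilon>^2 - \<epsilon>^2 * k^2 * \<rho> r * (v r)^2)
         + 2 * k^2 / r * (r - 2 * M)^2 * \<rho> r)) (at r)
    \<longleftrightarrow> \<epsilon>^2 * ((v r)^2 - k^2) / (v r * (1 - \<epsilon>^2 * (v r)^2)) * v'
        = (2 * a * r - (1 + 3 * a) * M) / (r * (r - 2 * M))"
    (is "(?mom has_real_derivative ?S) _ \<longleftrightarrow> ?L = ?R")
proof -
  \<comment> \<open>\<open>N\<close> is the flux, so that the momentum is \<open>N * Q\<close>.\<close>
  define N where "N = (\<lambda>s. s * (s - 2 * M) * ((1 + \<epsilon>^2 * k^2) / (1 - \<epsilon>^2 * (v s)^2)) * \<rho> s * v s)"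
  define Q where "Q = (\<lambda>s. (1 - 2 * M / s) * (v s + k^2 / v s) / (1 + a))"
  define V where "V = v r"
  define W where "W = 1 - \<epsilon>^2 * V^2"
  define d where "d = r - 2 * M"
  define Q' where "Q' = (2 * M / r^2 * (V + k^2 / V) + (1 - 2 * M / r) * (v' - k^2 * v' / V^2)) / (1 + a)"
  have pos: "r > 0" "d > 0" "V > 0" "W > 0" "1 + a > 0"
    using I v[OF I(3)] M_pos lorentz_pos[of V] a_bounds by (auto simp: d_def V_def W_def)
  have "(Q has_real_derivative Q') (at r)"
  proof -
    have 1: "((\<lambda>s. 1 - 2 * M / s) has_real_derivative 2 * M / r^2) (at r)"
      using pos by (auto intro!: derivative_eq_intros simp: power2_eq_square)
    have 2: "((\<lambda>s. v s + k^2 / v s) has_real_derivative v' - k^2 * v' / V^2) (at r)"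
      using pos dv by (auto intro!: derivative_eq_intros simp: V_def power2_eq_square)
    show ?thesis
      using DERIV_cdivide[OF DERIV_mult[OF 1 2], of "1 + a"]
      unfolding Q_def Q'_def V_def by (simp only: mult.commute)
  qed
  then have "((\<lambda>s. N s * Q s) has_real_derivative N r * Q') (at r)"
    using DERIV_mult[of N 0 r _ Q Q'] flux by (simp add: N_def mult.commute)
  moreover have "N s * Q s = ?mom s" if "s \<in> I" for s
  proof -
    have s: "s > 0" "v s > 0" using I that v M_pos by auto
    have "N s * Q s = (s - 2 * M) * \<rho> s / (1 - \<epsilon>^2 * (v s)^2) * (s * (1 - 2 * M / s)) * (v s * (v s + k^2 / v s)) * ((1 + a) / (1 + a))"
      unfolding N_def Q_def a_def[symmetric] by simp
    also have "s * (1 - 2 * M / s) = s - 2 * M" using s by (simp add: field_simps)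
    also have "v s * (v s + k^2 / v s) = (v s)^2 + k^2" using s by (simp add: field_simps power2_eq_square)
    finally show ?thesis using pos by (simp add: power2_eq_square)
  qed
  ultimately have dm: "(?mom has_real_derivative N r * Q') (at r)"
    by (rule has_field_derivative_transform_within_open[OF _ I(1,3)])
  have "N r * Q' - ?S = \<rho> r * d^2 / \<epsilon>^2 * (?L - ?R)"
  proof -
    have 1: "N r * Q' = \<rho> r * d / W * (2 * M / r * (V^2 + k^2) + d * v' * (V^2 - k^2) / V)"
    proof -
      have "N r * Q' = \<rho> r * d / W * (r * V * (2 * M / r^2 * (V + k^2 / V) + (1 - 2 * M / r) * (v' - k^2 * v' / V^2)))"
        using pos unfolding N_def Q'_def a_def[symmetric] V_def[symmetric] W_def[symmetric] d_def[symmetric]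
        by simp
      also have "r * V * (2 * M / r^2 * (V + k^2 / V) + (1 - 2 * M / r) * (v' - k^2 * v' / V^2))
        = 2 * M / r * (V^2 + k^2) + d * v' * (V^2 - k^2) / V"
        using pos unfolding d_def by (simp add: field_simps power2_eq_square)
      finally show ?thesis .
    qed
    have 2: "?S = \<rho> r * d / W * (M / r * (3 * V^2 + 3 * k^2 - 1 / \<epsilon>^2 - \<epsilon>^2 * k^2 * V^2) + 2 * k^2 * d * W / r)"
      using pos eps unfolding V_def[symmetric] W_def[symmetric] d_def[symmetric]
      by (simp add: field_simps power2_eq_square)
    have 3: "\<rho> r * d^2 / \<epsilon>^2 * (?L - ?R) = \<rho> r * d / W * (d * v' * (V^2 - k^2) / V - W / (\<epsilon>^2 * r) * (2 * a * r - (1 + 3 * a) * M))"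
      using pos eps unfolding V_def[symmetric] W_def[symmetric] d_def[symmetric]
      by (simp add: field_simps power2_eq_square)
    \<comment> \<open>The algebraic core: \<open>V\<^sup>2 + k\<^sup>2 - 1/\<epsilon>\<^sup>2 - \<epsilon>\<^sup>2k\<^sup>2V\<^sup>2\<close> factors as \<open>- (1 - a) W / \<epsilon>\<^sup>2\<close>.\<close>
    have "\<epsilon>^2 * (M * (3 * V^2 + 3 * k^2 - 1 / \<epsilon>^2 - \<epsilon>^2 * k^2 * V^2) + 2 * k^2 * d * W - 2 * M * (V^2 + k^2))
      = W * (2 * a * r - (1 + 3 * a) * M)"
    proof -
      have "\<epsilon>^2 * (M * (3 * V^2 + 3 * k^2 - 1 / \<epsilon>^2 - \<epsilon>^2 * k^2 * V^2) + 2 * k^2 * d * W - 2 * M * (V^2 + k^2))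
        = M * (3 * (\<epsilon>^2 * V^2) + 3 * a - 1 - a * (\<epsilon>^2 * V^2)) + 2 * a * d * W - 2 * M * (\<epsilon>^2 * V^2 + a)"
        using eps by (simp add: a_def algebra_simps)
      also have "\<dots> = W * (2 * a * r - (1 + 3 * a) * M)"
        unfolding W_def d_def by algebra
      finally show ?thesis .
    qed
    then have "M * (3 * V^2 + 3 * k^2 - 1 / \<epsilon>^2 - \<epsilon>^2 * k^2 * V^2) + 2 * k^2 * d * W - 2 * M * (V^2 + k^2)
      = W / \<epsilon>^2 * (2 * a * r - (1 + 3 * a) * M)"
      using eps by (simp add: eq_divide_eq mult_ac)
    then have "(M * (3 * V^2 + 3 * k^2 - 1 / \<epsilon>^2 - \<epsilon>^2 * k^2 * V^2) + 2 * k^2 * d * W - 2 * M * (V^2 + k^2)) / r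
      = W / (\<epsilon>^2 * r) * (2 * a * r - (1 + 3 * a) * M)"
      by simp
    then have "2 * M / r * (V^2 + k^2) - (M / r * (3 * V^2 + 3 * k^2 - 1 / \<epsilon>^2 - \<epsilon>^2 * k^2 * V^2) + 2 * k^2 * d * W / r)
      = - (W / (\<epsilon>^2 * r) * (2 * a * r - (1 + 3 * a) * M))"
      by (simp add: diff_divide_distrib add_divide_distrib)
    then show ?thesis unfolding 1 2 3 right_diff_distrib[symmetric] by (intro arg_cong2[where f="(*)"]) auto
  qed
  moreover have "\<rho> r * d^2 / \<epsilon>^2 \<noteq> 0" using pos eps \<rho> by simp
  ultimately have eq: "N r * Q' = ?S \<longleftrightarrow> ?L = ?R" by (metis mult_eq_0_iff right_minus_eq)
  show ?thesis
  proof
    assume "(?mom has_real_derivative ?S) (at r)"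
    then show "?L = ?R" using eq DERIV_unique[OF dm] by blast
  next
    assume "?L = ?R"
    then show "(?mom has_real_derivative ?S) (at r)" by (intro DERIV_cong[OF dm] eq[THEN iffD2])
  qed
qed

lemma constant_on_interval:
  fixes f :: "real \<Rightarrow> real"
  assumes "is_interval J" "\<And>r. r \<in> J \<Longrightarrow> (f has_real_derivative 0) (at r)" "r \<in> J" "r0 \<in> J"
  shows "f r = f r0"
proof -
  have "\<exists>c. \<forall>x\<in>J. f x = c"
    using assms(1,2) by (intro has_field_derivative_zero_constant)
      (auto simp: is_interval_convex_1 intro: has_field_derivative_at_within)
  then show ?thesis using assms(3,4) by auto
qed

lemma flux_conserved:
  assumes sol: "steady_Euler \<epsilon> k M J \<sigma> w" and "r0 \<in> J" "r \<in> J"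
  shows "r * (r - 2 * M) * ((1 + \<epsilon>^2 * k^2) / (1 - \<epsilon>^2 * (w r)^2)) * \<sigma> r * w r
    = r0 * (r0 - 2 * M) * ((1 + \<epsilon>^2 * k^2) / (1 - \<epsilon>^2 * (w r0)^2)) * \<sigma> r0 * w r0"
  using sol assms(2,3) unfolding steady_Euler_def
  by (intro constant_on_interval[of J "\<lambda>r. r * (r - 2 * M) * ((1 + \<epsilon>^2 * k^2) / (1 - \<epsilon>^2 * (w r)^2)) * \<sigma> r * w r"]) auto

text \<open>The flux is positive at \<open>r\<^sub>0\<close>, hence everywhere, so the fluid never comes to rest or turns back. This
keeps \<open>v\<close> in the domain of the potential, and both first integrals hold on all of \<open>J\<close>, through sonic
points as well.\<close>

lemma moving_solution:
  assumes sol: "steady_Euler_through \<epsilon> k M r0 \<rho>0 v0 J \<sigma> w" and v0: "v0 > 0" and r: "r \<in> J"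
  shows "0 < w r" "w r < 1 / \<epsilon>"
    "fluid_potential (w r) - fluid_potential k = geometric_potential r - sonic_level r0 v0"
    "\<sigma> r = r0 * (r0 - 2 * M) * \<rho>0 * v0 / (1 - \<epsilon>^2 * v0^2) * (1 - \<epsilon>^2 * (w r)^2) / (r * (r - 2 * M) * w r)"
proof -
  have E: "steady_Euler \<epsilon> k M J \<sigma> w" and r0: "r0 \<in> J" "\<sigma> r0 = \<rho>0" "w r0 = v0"
    using sol unfolding steady_Euler_through_def by auto
  have J: "open J" "is_interval J" "J \<subseteq> {2 * M<..}"
    and bd: "\<And>r. r \<in> J \<Longrightarrow> \<sigma> r > 0" "\<And>r. r \<in> J \<Longrightarrow> \<bar>w r\<bar> < 1 / \<epsilon>"
    using E unfolding steady_Euler_def by auto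
  have W: "1 - \<epsilon>^2 * (w r)^2 > 0" if "r \<in> J" for r
    using lorentz_pos[of "\<bar>w r\<bar>"] bd(2)[OF that] by simp
  have geo: "r > 0" "r - 2 * M > 0" if "r \<in> J" for r using that J M_pos by auto
  have "1 + \<epsilon>^2 * k^2 > 0" using a_bounds by (simp add: a_def)
  note pos = this W geo bd
  have wpos: "w r > 0" if "r \<in> J" for r
  proof -
    have "0 < r0 * (r0 - 2 * M) * ((1 + \<epsilon>^2 * k^2) / (1 - \<epsilon>^2 * (w r0)^2)) * \<sigma> r0 * w r0"
      using pos r0 v0 by (intro mult_pos_pos divide_pos_pos) auto
    then have "0 < r * (r - 2 * M) * ((1 + \<epsilon>^2 * k^2) / (1 - \<epsilon>^2 * (w r)^2)) * \<sigma> r * w r"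
      using flux_conserved[OF E r0(1) that] by simp
    moreover have "0 < r * (r - 2 * M) * ((1 + \<epsilon>^2 * k^2) / (1 - \<epsilon>^2 * (w r)^2)) * \<sigma> r"
      using pos that by (intro mult_pos_pos divide_pos_pos) auto
    ultimately show ?thesis by (rule zero_less_mult_pos)
  qed
  have wlt: "w r < 1 / \<epsilon>" if "r \<in> J" for r using bd(2)[OF that] by simp
  show "0 < w r" "w r < 1 / \<epsilon>" using wpos wlt r by auto
  have "((\<lambda>s. fluid_potential (w s) - geometric_potential s) has_real_derivative 0) (at s)"
    if s: "s \<in> J" for s
  proof -
    have "(deriv ^^ 0) w field_differentiable (at s)"
      using E s unfolding steady_Euler_def smooth_on_open_def by blast
    then obtain w' where w': "(w has_real_derivative w') (at s)"
      by (auto simp: field_differentiable_def)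
    have ode: "\<epsilon>^2 * ((w s)^2 - k^2) / (w s * (1 - \<epsilon>^2 * (w s)^2)) * w'
        = (2 * a * s - (1 + 3 * a) * M) / (s * (s - 2 * M))"
      by (rule momentum_balance_iff[THEN iffD1, OF J(1,3) s _ _ w'])
        (use E s wpos wlt in \<open>auto simp: steady_Euler_def\<close>)
    have "((\<lambda>s. fluid_potential (w s) - geometric_potential s) has_real_derivative
        2 / (1 - a) * (\<epsilon>^2 * ((w s)^2 - k^2) / (w s * (1 - \<epsilon>^2 * (w s)^2))) * w'
        - 2 / (1 - a) * ((2 * a * s - (1 + 3 * a) * M) / (s * (s - 2 * M)))) (at s)"
      using s J wpos wlt
      by (intro DERIV_diff DERIV_chain2[OF DERIV_fluid_potential w'] DERIV_geometric_potential) auto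
    then show ?thesis unfolding ode[symmetric] by simp
  qed
  then show "fluid_potential (w r) - fluid_potential k = geometric_potential r - sonic_level r0 v0"
    using constant_on_interval[OF J(2) _ r r0(1), of "\<lambda>s. fluid_potential (w s) - geometric_potential s"] r0
    by (simp add: sonic_level_def)
  define Y where "Y = r0 * (r0 - 2 * M) * \<rho>0 * v0 / (1 - \<epsilon>^2 * v0^2)"
  have "(1 + \<epsilon>^2 * k^2) * (r * (r - 2 * M) * \<sigma> r * w r / (1 - \<epsilon>^2 * (w r)^2)) = (1 + \<epsilon>^2 * k^2) * Y"
    using flux_conserved[OF E r0(1) r] r0 by (simp add: Y_def mult_ac)
  then have "r * (r - 2 * M) * \<sigma> r * w r / (1 - \<epsilon>^2 * (w r)^2) = Y"
    using pos(1) by (metis less_irrefl mult_left_cancel)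
  then have "\<sigma> r * (r * (r - 2 * M) * w r) = Y * (1 - \<epsilon>^2 * (w r)^2)"
    using pos(2)[OF r] by (simp add: divide_eq_eq mult_ac)
  then show "\<sigma> r = r0 * (r0 - 2 * M) * \<rho>0 * v0 / (1 - \<epsilon>^2 * v0^2) * (1 - \<epsilon>^2 * (w r)^2) / (r * (r - 2 * M) * w r)"
    unfolding Y_def[symmetric] using geo[OF r] wpos[OF r] by (simp add: eq_divide_eq)
qed

section \<open>Existence and uniqueness for moving fluids\<close>

text \<open>Where the geometric potential exceeds the sonic level the solution is not sonic, and by the
intermediate value theorem it cannot pass from one branch to the other.\<close>

lemma moving_solution_side:
  assumes sol: "steady_Euler_through \<epsilon> k M r0 \<rho>0 v0 J \<sigma> w" and v0: "v0 > 0"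
    and K: "is_interval K" "K \<subseteq> J" "r0 \<in> K" "\<And>r. r \<in> K \<Longrightarrow> sonic_level r0 v0 < geometric_potential r"
    and r: "r \<in> K"
  shows "sgn (w r - k) = sgn (v0 - k)"
proof (rule ccontr)
  assume ne: "sgn (w r - k) \<noteq> sgn (v0 - k)"
  have wk: "w s \<noteq> k" if "s \<in> K" for s
    using moving_solution(3)[OF sol v0, of s] K(2,4) that by fastforce
  have w0: "w r0 = v0" using sol by (simp add: steady_Euler_through_def)
  have "continuous_on K w"
  proof (rule continuous_at_imp_continuous_on, rule ballI)
    fix s assume "s \<in> K"
    then have "(deriv ^^ 0) w field_differentiable (at s)"
      using sol K(2) unfolding steady_Euler_through_def steady_Euler_def smooth_on_open_def by blast
    then show "isCont w s" using field_differentiable_imp_continuous_at by simp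
  qed
  then have "is_interval (w ` K)"
    using K(1) by (simp add: is_interval_connected_1 connected_continuous_image)
  moreover have "w r \<in> w ` K" "v0 \<in> w ` K" using r K(3) w0 by auto
  moreover have "w r < k \<and> k < v0 \<or> v0 < k \<and> k < w r"
    using ne wk[OF r] wk[OF K(3)] w0 by (auto simp: sgn_if split: if_splits)
  ultimately have "k \<in> w ` K" unfolding is_interval_1 by (meson less_imp_le)
  then show False using wk by auto
qed

lemma moving_solutions_agree:
  assumes sol: "steady_Euler_through \<epsilon> k M r0 \<rho>0 v0 I \<rho> v" "steady_Euler_through \<epsilon> k M r0 \<rho>0 v0 J \<sigma> w"
    and v0: "v0 > 0" and I: "\<And>r. r \<in> I \<Longrightarrow> sonic_level r0 v0 < geometric_potential r"
    and r: "r \<in> I \<inter> J"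
  shows "\<sigma> r = \<rho> r \<and> w r = v r"
proof -
  have K: "is_interval (I \<inter> J)" "r0 \<in> I \<inter> J"
    using sol unfolding steady_Euler_through_def steady_Euler_def by (auto intro: is_interval_Int)
  have "w r = v r"
  proof (rule valley_inj_on_side[OF valley_fluid_potential])
    show "w r \<in> {0<..<1 / \<epsilon>}" "v r \<in> {0<..<1 / \<epsilon>}"
      using moving_solution(1,2)[OF sol(1) v0] moving_solution(1,2)[OF sol(2) v0] r by auto
    show "sgn (w r - k) = sgn (v r - k)"
      using moving_solution_side[OF sol(1) v0 K(1) _ K(2) _ r]
        moving_solution_side[OF sol(2) v0 K(1) _ K(2) _ r] I by auto
    show "fluid_potential (w r) = fluid_potential (v r)"
      using moving_solution(3)[OF sol(1) v0, of r] moving_solution(3)[OF sol(2) v0, of r] r by auto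
  qed
  then show ?thesis
    using moving_solution(4)[OF sol(1) v0, of r] moving_solution(4)[OF sol(2) v0, of r] r by auto
qed

text \<open>The velocity is obtained by inverting the branch of the fluid potential that contains \<open>v\<^sub>0\<close>, and the
density from the conserved flux.\<close>

lemma moving_solution_exists:
  assumes r0: "r0 \<in> I" and \<rho>0: "\<rho>0 > 0" and v0: "0 < v0" "v0 < 1 / \<epsilon>" "v0 \<noteq> k"
    and I: "open I" "is_interval I" "I \<subseteq> {2 * M<..}"
    and level: "\<And>r. r \<in> I \<Longrightarrow> sonic_level r0 v0 < geometric_potential r"
  obtains \<rho> v where "steady_Euler_through \<epsilon> k M r0 \<rho>0 v0 I \<rho> v"
proof -
  define s where "s = sgn (v0 - k)"
  have s: "s = 1 \<or> s = -1" using v0 by (auto simp: s_def sgn_if)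
  define y where "y r = fluid_potential k + (geometric_potential r - sonic_level r0 v0)" for r
  define G where "G = the_inv_into {x \<in> {0<..<1 / \<epsilon>}. sgn (x - k) = s} fluid_potential"
  define F where "F x = 2 / (1 - a) * (\<epsilon>^2 * (x^2 - k^2) / (x * (1 - \<epsilon>^2 * x^2)))" for x
  define R where "R r = (2 * a * r - (1 + 3 * a) * M) / (r * (r - 2 * M))" for r
  define v where "v r = G (y r)" for r
  define C where "C = r0 * (r0 - 2 * M) * \<rho>0 * v0 / (1 - \<epsilon>^2 * v0^2)"
  define \<rho> where "\<rho> r = C * (1 - \<epsilon>^2 * (v r)^2) / (r * (r - 2 * M) * v r)" for r
  have W: "1 - \<epsilon>^2 * x^2 > 0" if "x \<in> {0<..<1 / \<epsilon>}" for x
    using lorentz_pos[of x] that by auto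
  have nz: "x^2 - k^2 \<noteq> 0" if "x \<in> {0<..<1 / \<epsilon>}" "x \<noteq> k" for x
    using that k_pos by (simp add: power2_eq_iff)
  have F: "(fluid_potential has_real_derivative F x) (at x)" "x \<noteq> k \<longrightarrow> F x \<noteq> 0"
    if "x \<in> {0<..<1 / \<epsilon>}" for x
    using DERIV_fluid_potential[of x] nz[of x] W[of x] that eps a_bounds by (auto simp: F_def)
  note inv = valley_local_inverse[OF valley_fluid_potential s _ F(1) F(2)[rule_format], folded G_def]
  have vB: "v r \<in> {0<..<1 / \<epsilon>}" "sgn (v r - k) = s" "fluid_potential (v r) = y r"
    and dG: "(G has_real_derivative inverse (F (v r))) (at (y r))" if "r \<in> I" for r
    using inv[of "y r"] level[OF that] by (auto simp: y_def v_def)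
  have vk: "v r \<noteq> k" if "r \<in> I" for r using vB(2)[OF that] s by auto
  have geo: "r > 0" "r - 2 * M > 0" if "r \<in> I" for r using that I M_pos by auto
  have v0': "v r0 = v0"
    by (rule valley_inj_on_side[OF valley_fluid_potential])
      (use vB[OF r0] v0 in \<open>auto simp: s_def y_def sonic_level_def\<close>)
  have dv: "(v has_real_derivative v r * (1 - \<epsilon>^2 * (v r)^2) / (\<epsilon>^2 * ((v r)^2 - k^2)) * R r) (at r)"
    if r: "r \<in> I" for r
  proof -
    have "(y has_real_derivative 2 / (1 - a) * R r) (at r)"
      unfolding y_def R_def using DERIV_geometric_potential[of r] I r
      by (auto intro!: derivative_eq_intros)
    then have "((\<lambda>r. G (y r)) has_real_derivative inverse (F (v r)) * (2 / (1 - a) * R r)) (at r)"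
      by (rule DERIV_chain2[where f=G and g=y, OF dG[OF r]])
    moreover have "inverse (F (v r)) * (2 / (1 - a) * R r)
        = v r * (1 - \<epsilon>^2 * (v r)^2) / (\<epsilon>^2 * ((v r)^2 - k^2)) * R r"
      using a_bounds by (simp add: F_def)
    ultimately show ?thesis unfolding v_def by simp
  qed
  have v_rat: "v \<in> rational_in I v" by (rule rational_in.unknown)
  have dv_rat: "(\<lambda>r. v r * (1 - \<epsilon>^2 * (v r)^2) / (\<epsilon>^2 * ((v r)^2 - k^2)) * R r) \<in> rational_in I v"
    unfolding R_def using geo nz vB vk eps
    by (intro rational_in_intros) (auto simp del: greaterThanLessThan_iff)
  have \<rho>_rat: "\<rho> \<in> rational_in I v"
    unfolding \<rho>_def[abs_def] using geo vB by (intro rational_in_intros) fastforce+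
  have C: "C > 0"
    unfolding C_def using geo[OF r0] \<rho>0 v0 W[of v0] by simp
  have \<rho>: "\<rho> r > 0" if "r \<in> I" for r
    unfolding \<rho>_def using C geo[OF that] vB(1)[OF that] W[of "v r"] by simp
  have flux: "((\<lambda>s. s * (s - 2 * M) * ((1 + \<epsilon>^2 * k^2) / (1 - \<epsilon>^2 * (v s)^2)) * \<rho> s * v s)
      has_real_derivative 0) (at r)" if r: "r \<in> I" for r
  proof (rule has_field_derivative_transform_within_open[OF DERIV_const I(1) r])
    fix s assume "s \<in> I"
    then show "(1 + \<epsilon>^2 * k^2) * C = s * (s - 2 * M) * ((1 + \<epsilon>^2 * k^2) / (1 - \<epsilon>^2 * (v s)^2)) * \<rho> s * v s"
      unfolding \<rho>_def using geo[of s] vB(1)[of s] W[of "v s"] by simp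
  qed
  have "steady_Euler \<epsilon> k M I \<rho> v"
    unfolding steady_Euler_def
  proof (intro conjI ballI)
    show "smooth_on_open \<rho> I" by (rule rational_in_smooth[OF I(1) dv_rat dv \<rho>_rat])
    show "smooth_on_open v I" by (rule rational_in_smooth[OF I(1) dv_rat dv v_rat])
    fix r assume r: "r \<in> I"
    show "\<rho> r > 0" "\<bar>v r\<bar> < 1 / \<epsilon>" using \<rho>[OF r] vB(1)[OF r] by auto
    show "((\<lambda>s. s * (s - 2 * M) * ((1 + \<epsilon>^2 * k^2) / (1 - \<epsilon>^2 * (v s)^2)) * \<rho> s * v s)
      has_real_derivative 0) (at r)" by (rule flux[OF r])
    show "((\<lambda>s. (s - 2 * M)^2 * (((v s)^2 + k^2) / (1 - \<epsilon>^2 * (v s)^2)) * \<rho> s)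
      has_real_derivative
        (M / r * ((r - 2 * M) / (1 - \<epsilon>^2 * (v r)^2)) *
           (3 * \<rho> r * (v r)^2 + 3 * k^2 * \<rho> r - \<rho> r / \<epsilon>^2 - \<epsilon>^2 * k^2 * \<rho> r * (v r)^2)
         + 2 * k^2 / r * (r - 2 * M)^2 * \<rho> r)) (at r)"
    proof (rule momentum_balance_iff[THEN iffD2, OF I(1,3) r _ \<rho>[OF r] dv[OF r] flux[OF r]])
      show "0 < v s \<and> v s < 1 / \<epsilon>" if "s \<in> I" for s using vB(1)[OF that] by simp
      show "\<epsilon>^2 * ((v r)^2 - k^2) / (v r * (1 - \<epsilon>^2 * (v r)^2)) *
          (v r * (1 - \<epsilon>^2 * (v r)^2) / (\<epsilon>^2 * ((v r)^2 - k^2)) * R r)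
        = (2 * a * r - (1 + 3 * a) * M) / (r * (r - 2 * M))"
        using vB(1)[OF r] W[OF vB(1)[OF r]] nz[OF vB(1)[OF r] vk[OF r]] eps by (simp add: R_def)
    qed
  qed (use I in auto)
  moreover have "\<rho> r0 = \<rho>0"
    unfolding \<rho>_def v0' C_def using geo[OF r0] v0 W[of v0] by simp
  ultimately show thesis
    using that[of \<rho> v] r0 v0' by (simp add: steady_Euler_through_def)
qed

lemma velocity_tendsto_sonic:
  assumes sol: "steady_Euler_through \<epsilon> k M r0 \<rho>0 v0 I \<rho> v" and v0: "v0 > 0"
    and I: "\<And>r. r \<in> I \<Longrightarrow> sonic_level r0 v0 < geometric_potential r"
    and q: "2 * M < q" "geometric_potential q = sonic_level r0 v0"
  shows "(v \<longlongrightarrow> k) (at q within I)"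
proof (rule valley_inverse_tendsto[OF valley_fluid_potential])
  have I': "is_interval I" "r0 \<in> I" "v r0 = v0"
    using sol by (auto simp: steady_Euler_through_def steady_Euler_def)
  have "v0 \<noteq> k"
    using moving_solution(3)[OF sol v0 I'(2)] I[OF I'(2)] I'(3) by auto
  then show "sgn (v0 - k) = 1 \<or> sgn (v0 - k) = -1" by (auto simp: sgn_if)
  show "\<forall>\<^sub>F r in at q within I. v r \<in> {0<..<1 / \<epsilon>} \<and> sgn (v r - k) = sgn (v0 - k)"
    using moving_solution(1,2)[OF sol v0] moving_solution_side[OF sol v0 I'(1) order_refl I'(2) I]
    by (auto simp: eventually_at_filter intro!: always_eventually)
  have "isCont geometric_potential q"
    using DERIV_geometric_potential[OF q(1)] by (rule DERIV_isCont)
  then have "(geometric_potential \<longlongrightarrow> sonic_level r0 v0) (at q within I)"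
    using q(2) continuous_at_imp_continuous_at_within[of q geometric_potential I]
    by (simp add: continuous_within)
  then have lim: "((\<lambda>r. fluid_potential k + (geometric_potential r - sonic_level r0 v0)) \<longlongrightarrow>
      fluid_potential k) (at q within I)"
    by (auto intro!: tendsto_eq_intros)
  show "((\<lambda>r. fluid_potential (v r)) \<longlongrightarrow> fluid_potential k) (at q within I)"
    by (rule Lim_transform_eventually[OF lim])
      (use moving_solution(3)[OF sol v0] in \<open>auto simp: eventually_at_filter algebra_simps intro!: always_eventually\<close>)
qed

section \<open>The fluid at rest\<close>

text \<open>For \<open>v = 0\<close> the momentum equation is the linear equation \<open>T' = rest_exponent' T\<close> for
\<open>T = (r - 2M)\<^sup>2 k\<^sup>2 \<rho>\<close>, so that \<open>T\<close> is a multiple of \<open>exp rest_exponent\<close>.\<close>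

definition rest_exponent :: "real \<Rightarrow> real" where
  "rest_exponent r = (3 - 1 / a) / 2 * (ln (r - 2 * M) - ln r) + 2 * ln r"

definition rest_exponent' :: "real \<Rightarrow> real" where
  "rest_exponent' r = (3 - 1 / a) * M / (r * (r - 2 * M)) + 2 / r"

lemma DERIV_rest_exponent:
  assumes "2 * M < r"
  shows "(rest_exponent has_real_derivative rest_exponent' r) (at r)"
proof -
  have r: "r > 0" "r - 2 * M > 0" using assms M_pos by auto
  have "(rest_exponent has_real_derivative (3 - 1 / a) / 2 * (1 / (r - 2 * M) - 1 / r) + 2 * (1 / r)) (at r)"
    unfolding rest_exponent_def using r by (auto intro!: derivative_eq_intros)
  moreover have "1 / (r - 2 * M) - 1 / r = 2 * M / (r * (r - 2 * M))"
    using r by (simp add: field_simps)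
  ultimately show ?thesis by (simp add: rest_exponent'_def)
qed

lemma rest_momentum_source:
  assumes "2 * M < r"
  shows "M / r * (r - 2 * M) * (3 * k^2 * x - x / \<epsilon>^2) + 2 * k^2 / r * (r - 2 * M)^2 * x
    = (r - 2 * M)^2 * k^2 * x * rest_exponent' r"
proof -
  have r: "r > 0" "r - 2 * M > 0" using assms M_pos by auto
  define c where "c = 3 - 1 / a"
  have "3 * k^2 * x - x / \<epsilon>^2 = k^2 * x * c"
    using k_pos eps by (simp add: a_def c_def field_simps)
  then show ?thesis
    using r unfolding rest_exponent'_def c_def[symmetric] by (simp add: field_simps power2_eq_square)
qed

lemma rest_solution:
  assumes sol: "steady_Euler_through \<epsilon> k M r0 \<rho>0 0 J \<sigma> w" and r: "r \<in> J"
  shows "w r = 0"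
    "\<sigma> r = \<rho>0 * (r0 - 2 * M)^2 / exp (rest_exponent r0) * exp (rest_exponent r) / (r - 2 * M)^2"
proof -
  have E: "steady_Euler \<epsilon> k M J \<sigma> w" and r0: "r0 \<in> J" "\<sigma> r0 = \<rho>0" "w r0 = 0"
    using sol unfolding steady_Euler_through_def by auto
  have J: "open J" "is_interval J" "J \<subseteq> {2 * M<..}"
    and bd: "\<And>r. r \<in> J \<Longrightarrow> \<sigma> r > 0" "\<And>r. r \<in> J \<Longrightarrow> \<bar>w r\<bar> < 1 / \<epsilon>"
    using E unfolding steady_Euler_def by auto
  have w0: "w r = 0" if "r \<in> J" for r
  proof -
    have "1 - \<epsilon>^2 * (w r)^2 > 0" using lorentz_pos[of "\<bar>w r\<bar>"] bd(2)[OF that] by simp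
    moreover have "1 + \<epsilon>^2 * k^2 > 0" using a_bounds by (simp add: a_def)
    moreover have "r * (r - 2 * M) * ((1 + \<epsilon>^2 * k^2) / (1 - \<epsilon>^2 * (w r)^2)) * \<sigma> r * w r = 0"
      using flux_conserved[OF E r0(1) that] r0 by simp
    ultimately show ?thesis using bd(1)[OF that] J that M_pos by auto
  qed
  then show "w r = 0" using r .
  have "((\<lambda>s. (s - 2 * M)^2 * k^2 * \<sigma> s * exp (- rest_exponent s)) has_real_derivative 0) (at s)"
    if s: "s \<in> J" for s
  proof -
    have s2: "2 * M < s" using J s by auto
    have "((\<lambda>s. (s - 2 * M)^2 * (((w s)^2 + k^2) / (1 - \<epsilon>^2 * (w s)^2)) * \<sigma> s)
      has_real_derivative
        (M / s * ((s - 2 * M) / (1 - \<epsilon>^2 * (w s)^2)) *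
           (3 * \<sigma> s * (w s)^2 + 3 * k^2 * \<sigma> s - \<sigma> s / \<epsilon>^2 - \<epsilon>^2 * k^2 * \<sigma> s * (w s)^2)
         + 2 * k^2 / s * (s - 2 * M)^2 * \<sigma> s)) (at s)"
      (is "(?f has_real_derivative ?S) _")
      using E s unfolding steady_Euler_def by blast
    then have "((\<lambda>s. (s - 2 * M)^2 * k^2 * \<sigma> s) has_real_derivative ?S) (at s)"
      by (rule has_field_derivative_transform_within_open[OF _ J(1) s]) (simp add: w0)
    moreover have "?S = (s - 2 * M)^2 * k^2 * \<sigma> s * rest_exponent' s"
      using rest_momentum_source[OF s2, of "\<sigma> s"] w0[OF s] by simp
    ultimately have "((\<lambda>s. (s - 2 * M)^2 * k^2 * \<sigma> s) has_real_derivative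
        (s - 2 * M)^2 * k^2 * \<sigma> s * rest_exponent' s) (at s)"
      by (rule DERIV_cong)
    then have "((\<lambda>s. (s - 2 * M)^2 * k^2 * \<sigma> s * exp (- rest_exponent s)) has_real_derivative
        (s - 2 * M)^2 * k^2 * \<sigma> s * rest_exponent' s * exp (- rest_exponent s)
        + exp (- rest_exponent s) * - rest_exponent' s * ((s - 2 * M)^2 * k^2 * \<sigma> s)) (at s)"
      by (rule DERIV_mult) (intro DERIV_fun_exp DERIV_minus DERIV_rest_exponent s2)
    then show ?thesis by (simp add: mult_ac)
  qed
  from constant_on_interval[OF J(2) this r r0(1)]
  have "(r - 2 * M)^2 * \<sigma> r * exp (- rest_exponent r) = (r0 - 2 * M)^2 * \<rho>0 * exp (- rest_exponent r0)"
    using r0 k_pos by simp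
  moreover have "r - 2 * M \<noteq> 0" using r J by auto
  ultimately show "\<sigma> r = \<rho>0 * (r0 - 2 * M)^2 / exp (rest_exponent r0) * exp (rest_exponent r) / (r - 2 * M)^2"
    by (simp add: exp_minus field_simps)
qed

lemma rest_solution_exists:
  assumes r0: "2 * M < r0" and \<rho>0: "\<rho>0 > 0"
  obtains \<rho> where "steady_Euler_through \<epsilon> k M r0 \<rho>0 0 {2 * M<..} \<rho> (\<lambda>_. 0)"
proof -
  let ?I = "{2 * M<..}"
  define C where "C = \<rho>0 * (r0 - 2 * M)^2 / exp (rest_exponent r0)"
  define u where "u r = exp (rest_exponent r)" for r
  define \<rho> where "\<rho> r = C * u r / (r - 2 * M)^2" for r
  have C: "C > 0" using assms by (simp add: C_def)
  have du: "(u has_real_derivative u r * rest_exponent' r) (at r)" if "r \<in> ?I" for r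
    unfolding u_def using that by (intro DERIV_fun_exp DERIV_rest_exponent) auto
  have du_rat: "(\<lambda>r. u r * rest_exponent' r) \<in> rational_in ?I u"
    unfolding rest_exponent'_def using M_pos by (intro rational_in_intros) auto
  have rat: "\<rho> \<in> rational_in ?I u" "(\<lambda>_. 0) \<in> rational_in ?I u"
    unfolding \<rho>_def[abs_def] by (intro rational_in_intros; auto)+
  have "steady_Euler \<epsilon> k M ?I \<rho> (\<lambda>_. 0)"
    unfolding steady_Euler_def
  proof (intro conjI ballI)
    show "smooth_on_open \<rho> ?I" by (rule rational_in_smooth[OF _ du_rat du rat(1)]) auto
    show "smooth_on_open (\<lambda>_. 0) ?I" by (rule rational_in_smooth[OF _ du_rat du rat(2)]) auto
    fix r assume r: "r \<in> ?I"
    show "\<rho> r > 0" using r C by (simp add: \<rho>_def u_def)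
    have "((\<lambda>s. k^2 * C * u s) has_real_derivative k^2 * C * (u r * rest_exponent' r)) (at r)"
      by (intro DERIV_cmult du r)
    then have "((\<lambda>s. (s - 2 * M)^2 * k^2 * \<rho> s) has_real_derivative k^2 * C * (u r * rest_exponent' r)) (at r)"
      by (rule has_field_derivative_transform_within_open[OF _ _ r]) (auto simp: \<rho>_def)
    also have "k^2 * C * (u r * rest_exponent' r) = (r - 2 * M)^2 * k^2 * \<rho> r * rest_exponent' r"
      using r by (simp add: \<rho>_def)
    finally show "((\<lambda>s. (s - 2 * M)^2 * ((0^2 + k^2) / (1 - \<epsilon>^2 * 0^2)) * \<rho> s)
      has_real_derivative
        (M / r * ((r - 2 * M) / (1 - \<epsilon>^2 * 0^2)) *
           (3 * \<rho> r * 0^2 + 3 * k^2 * \<rho> r - \<rho> r / \<epsilon>^2 - \<epsilon>^2 * k^2 * \<rho> r * 0^2)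
         + 2 * k^2 / r * (r - 2 * M)^2 * \<rho> r)) (at r)"
      using rest_momentum_source[of r "\<rho> r"] r by simp
  qed (use eps in \<open>auto simp: is_interval_1\<close>)
  moreover have "\<rho> r0 = \<rho>0" using r0 by (simp add: \<rho>_def u_def C_def)
  ultimately show thesis using that r0 by (simp add: steady_Euler_through_def)
qed

section \<open>The steady state and its domain\<close>

lemma transonic_free_state_exists:
  assumes data: "r0 \<in> I" "\<rho>0 > 0" "0 < v0" "v0 < 1 / \<epsilon>" "v0 \<noteq> k"
    and I: "open I" "is_interval I" "I \<subseteq> {2 * M<..}"
    and level: "\<And>r. r \<in> I \<Longrightarrow> sonic_level r0 v0 < geometric_potential r"
    and maximal: "\<And>J \<sigma> w. steady_Euler_through \<epsilon> k M r0 \<rho>0 v0 J \<sigma> w \<Longrightarrow>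
      P_sonic \<epsilon> k M r0 v0 \<noteq> 0 \<or> (\<forall>r\<in>J. w r \<noteq> k) \<Longrightarrow> J \<subseteq> I"
  obtains \<rho> v where "is_the_steady_state \<epsilon> k M r0 \<rho>0 v0 I \<rho> v"
    "\<And>r. r \<in> I \<Longrightarrow> sgn (v r - k) = sgn (v0 - k)"
    "\<And>q. 2 * M < q \<Longrightarrow> geometric_potential q = sonic_level r0 v0 \<Longrightarrow> (v \<longlongrightarrow> k) (at q within I)"
proof -
  obtain \<rho> v where sol: "steady_Euler_through \<epsilon> k M r0 \<rho>0 v0 I \<rho> v"
    using moving_solution_exists[OF data I level] by blast
  show thesis
  proof (rule that[of \<rho> v])
    show "is_the_steady_state \<epsilon> k M r0 \<rho>0 v0 I \<rho> v"
      unfolding is_the_steady_state_def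
      using sol moving_solutions_agree[OF sol _ data(3) level] maximal by blast
    show "sgn (v r - k) = sgn (v0 - k)" if "r \<in> I" for r
      by (rule moving_solution_side[OF sol data(3) I(2) order_refl data(1) level that])
    show "(v \<longlongrightarrow> k) (at q within I)" if "2 * M < q" "geometric_potential q = sonic_level r0 v0" for q
      by (rule velocity_tendsto_sonic[OF sol data(3) level that])
  qed
qed

lemma moving_solution_above_level:
  assumes sol: "steady_Euler_through \<epsilon> k M r0 \<rho>0 v0 J \<sigma> w" and v0: "v0 > 0" and r: "r \<in> J"
  shows "sonic_level r0 v0 \<le> geometric_potential r"
    "w r \<noteq> k \<Longrightarrow> sonic_level r0 v0 < geometric_potential r"
proof -
  have "w r \<in> {0<..<1 / \<epsilon>}" using moving_solution(1,2)[OF sol v0 r] by simp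
  then have "w r \<noteq> k \<Longrightarrow> fluid_potential k < fluid_potential (w r)"
    by (rule valley_min_less[OF valley_fluid_potential])
  then show "sonic_level r0 v0 \<le> geometric_potential r"
    "w r \<noteq> k \<Longrightarrow> sonic_level r0 v0 < geometric_potential r"
    using moving_solution(3)[OF sol v0 r] by (cases "w r = k"; simp)+
qed

text \<open>Between the sonic points the level exceeds the geometric potential, which no solution allows. A solution
defined at a sonic point would, its domain being open, reach into this gap. That argument breaks down
only if the gap is empty, that is for coinciding sonic points, and there the solution is assumed not
to be sonic.\<close>

lemma moving_solution_avoids_gap:
  assumes sol: "steady_Euler_through \<epsilon> k M r0 \<rho>0 v0 J \<sigma> w" and v0: "v0 > 0"
    and gap: "P_sonic \<epsilon> k M r0 v0 \<noteq> 0 \<or> (\<forall>r\<in>J. w r \<noteq> k)"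
    and lo: "2 * M < lo"
    and level: "\<And>r. 2 * M < r \<Longrightarrow> sonic_level r0 v0 < geometric_potential r \<longleftrightarrow> r < lo \<or> hi < r"
    and eq: "{r \<in> {2 * M<..}. geometric_potential r = sonic_level r0 v0} = {lo, hi}"
    and strict: "P_sonic \<epsilon> k M r0 v0 \<noteq> 0 \<Longrightarrow> lo < hi"
    and r: "r \<in> J"
  shows "r < lo \<or> hi < r"
proof (rule ccontr)
  assume c: "\<not> (r < lo \<or> hi < r)"
  have J: "open J" "J \<subseteq> {2 * M<..}"
    using sol unfolding steady_Euler_through_def steady_Euler_def by auto
  have at_edge: "s = lo \<or> s = hi" if s: "s \<in> J" "lo \<le> s" "s \<le> hi" for s
  proof -
    have "\<not> sonic_level r0 v0 < geometric_potential s" using level[of s] s lo by auto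
    then have "geometric_potential s = sonic_level r0 v0"
      using moving_solution_above_level(1)[OF sol v0 s(1)] by simp
    then have "s \<in> {r \<in> {2 * M<..}. geometric_potential r = sonic_level r0 v0}" using s lo by simp
    then show ?thesis unfolding eq by simp
  qed
  show False
  proof (cases "P_sonic \<epsilon> k M r0 v0 = 0")
    case True
    then have "sonic_level r0 v0 < geometric_potential r"
      using gap moving_solution_above_level(2)[OF sol v0 r] r by blast
    then show False using level[of r] r J c by auto
  next
    case False
    then have lh: "lo < hi" by (rule strict)
    obtain d where d: "d > 0" "ball r d \<subseteq> J" using J(1) r by (meson openE)
    \<comment> \<open>Move from the sonic point into the gap by less than the radius \<open>d\<close> and the width of the gap.\<close>
    define m where "m = min d (hi - lo) / 2"
    have m: "0 < m" "m < d" "m < hi - lo" using lh d(1) by (auto simp: m_def min_def)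
    define x where "x = (if r = lo then r + m else r - m)"
    have "r = lo \<or> r = hi" using at_edge[OF r] c by auto
    then have "lo < x" "x < hi" "dist r x < d"
      using lh m by (auto simp: x_def dist_real_def)
    then show False using at_edge[of x] d(2) by auto
  qed
qed

end

theorem theorem5p7:
  fixes \<epsilon> k M r0 \<rho>0 v0 :: real
  assumes "\<epsilon> > 0" and "0 < k" and "k < 1 / \<epsilon>" and "M > 0"
    and "r0 > 2 * M" and "\<rho>0 > 0" and "0 \<le> v0" and "v0 < 1 / \<epsilon>" and "v0 \<noteq> k"
  shows "\<exists>I \<rho> v.
    is_the_steady_state \<epsilon> k M r0 \<rho>0 v0 I \<rho> v \<and>
    (\<forall>r\<in>I. sgn (v r - k) = sgn (v0 - k)) \<and>
    (P_sonic \<epsilon> k M r0 v0 > 0 \<longrightarrow> I = {2 * M<..}) \<and>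
    (P_sonic \<epsilon> k M r0 v0 \<le> 0 \<longrightarrow>
      (\<exists>rlo rhi. rlo \<le> rhi \<and> sonic_points \<epsilon> k M r0 v0 = {rlo, rhi} \<and>
        I \<subset> {2 * M<..} \<and>
        (r0 < (2 - kappa \<epsilon> k) / (1 - kappa \<epsilon> k) * M \<longrightarrow>
           I = {2 * M<..<rlo} \<and> (v \<longlongrightarrow> k) (at_left rlo)) \<and>
        (r0 \<ge> (2 - kappa \<epsilon> k) / (1 - kappa \<epsilon> k) * M \<longrightarrow>
           I = {rhi<..} \<and> (v \<longlongrightarrow> k) (at_right rhi))))"
proof -
  interpret schwarzschild_fluid \<epsilon> k M
    using assms by unfold_locales auto
  have rc: "(2 - kappa \<epsilon> k) / (1 - kappa \<epsilon> k) * M = r_crit"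
    by (simp add: kappa_eq r_crit_def)
  have sub: "J \<subseteq> {2 * M<..}" if "steady_Euler_through \<epsilon> k M r0 \<rho>0 v0 J \<sigma> w" for J \<sigma> w
    using that by (auto simp: steady_Euler_through_def steady_Euler_def)
  show ?thesis
  proof (cases "v0 = 0")
    case True
    obtain \<rho> where sol: "steady_Euler_through \<epsilon> k M r0 \<rho>0 0 {2 * M<..} \<rho> (\<lambda>_. 0)"
      using rest_solution_exists[OF assms(5,6)] by blast
    have "\<sigma> r = \<rho> r \<and> w r = 0"
      if "steady_Euler_through \<epsilon> k M r0 \<rho>0 0 J \<sigma> w" "r \<in> {2 * M<..} \<inter> J" for J \<sigma> w r
      using rest_solution[OF sol, of r] rest_solution[OF that(1), of r] that(2) by auto
    then have "is_the_steady_state \<epsilon> k M r0 \<rho>0 v0 {2 * M<..} \<rho> (\<lambda>_. 0)"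
      unfolding is_the_steady_state_def using sol sub True by blast
    moreover have "P_sonic \<epsilon> k M r0 v0 = \<infinity>" using True by (simp add: P_sonic_def)
    ultimately show ?thesis
      using True by (intro exI[of _ "{2 * M<..}"] exI[of _ \<rho>] exI[of _ "\<lambda>_. 0"]) auto
  next
    case False
    then have v0: "0 < v0" "v0 < 1 / \<epsilon>" "v0 \<noteq> k" using assms by auto
    define L where "L = sonic_level r0 v0"
    have P: "P_sonic \<epsilon> k M r0 v0 = ereal ((geometric_potential r_crit - L) / b)"
      unfolding L_def by (rule P_sonic_eq[OF assms(5) v0(1,2)])
    have "fluid_potential k < fluid_potential v0"
      by (rule valley_min_less[OF valley_fluid_potential]) (use v0 in auto)
    then have L0: "L < geometric_potential r0" by (simp add: L_def sonic_level_def)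
    show ?thesis
    proof (cases "P_sonic \<epsilon> k M r0 v0 > 0")
      case True
      then have "L < geometric_potential r_crit" using P b_pos by (simp add: zero_less_divide_iff)
      then have level: "L < geometric_potential r" if "r \<in> {2 * M<..}" for r
        using valley_min_less[OF valley_geometric_potential that] by (cases "r = r_crit") auto
      have r0I: "r0 \<in> {2 * M<..}" using assms(5) by simp
      obtain \<rho> v where "is_the_steady_state \<epsilon> k M r0 \<rho>0 v0 {2 * M<..} \<rho> v"
          "\<And>r. r \<in> {2 * M<..} \<Longrightarrow> sgn (v r - k) = sgn (v0 - k)"
          "\<And>q. 2 * M < q \<Longrightarrow> geometric_potential q = sonic_level r0 v0 \<Longrightarrow> (v \<longlongrightarrow> k) (at q within {2 * M<..})"
        by (rule transonic_free_state_exists[OF r0I assms(6) v0 _ _ order_refl level[unfolded L_def] sub])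
          (simp_all add: is_interval_1)
      then show ?thesis
        using True by - (rule exI[of _ "{2 * M<..}"], rule exI[of _ \<rho>], rule exI[of _ v], auto)
    next
      case nonpos: False
      then have "geometric_potential r_crit \<le> L" using P b_pos by (simp add: zero_less_divide_iff)
      then obtain lo hi where lohi: "lo \<in> {2 * M<..}" "hi \<in> {2 * M<..}" "lo \<le> r_crit" "r_crit \<le> hi"
          and eq: "{r \<in> {2 * M<..}. geometric_potential r = L} = {lo, hi}"
          and level: "\<And>r. r \<in> {2 * M<..} \<Longrightarrow> L < geometric_potential r \<longleftrightarrow> r < lo \<or> hi < r"
          and strict: "geometric_potential r_crit < L \<Longrightarrow> lo < hi"
        by (rule valley_level_set[OF valley_geometric_potential]) blast
      have strict': "lo < hi" if "P_sonic \<epsilon> k M r0 v0 \<noteq> 0"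
        using that nonpos P b_pos by (intro strict) (auto simp: zero_less_divide_iff zero_ereal_def)
      have edge: "geometric_potential lo = L" "geometric_potential hi = L" using eq by blast+
      have r0: "r0 < lo \<or> hi < r0" using level[of r0] L0 assms(5) by simp
      have gap: "r < lo \<or> hi < r"
        if "steady_Euler_through \<epsilon> k M r0 \<rho>0 v0 J \<sigma> w"
          "P_sonic \<epsilon> k M r0 v0 \<noteq> 0 \<or> (\<forall>r\<in>J. w r \<noteq> k)" "r \<in> J" for J \<sigma> w r
        by (rule moving_solution_avoids_gap[OF that(1) v0(1) that(2) _ _ _ strict' that(3)])
          (use lohi level eq in \<open>auto simp: L_def\<close>)
      have J: "is_interval J" "r0 \<in> J" if "steady_Euler_through \<epsilon> k M r0 \<rho>0 v0 J \<sigma> w" for J \<sigma> w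
        using that by (auto simp: steady_Euler_through_def steady_Euler_def)
      have sonic: "sonic_points \<epsilon> k M r0 v0 = {lo, hi}"
        using sonic_points_eq[OF assms(5) v0(1,2)] eq by (simp add: L_def)
      show ?thesis
      proof (cases "r0 < r_crit")
        case left: True
        let ?I = "{2 * M<..<lo}"
        have r0I: "r0 \<in> ?I" using left r0 lohi assms(5) by auto
        obtain \<rho> v where st: "is_the_steady_state \<epsilon> k M r0 \<rho>0 v0 ?I \<rho> v"
            "\<And>r. r \<in> ?I \<Longrightarrow> sgn (v r - k) = sgn (v0 - k)"
            "\<And>q. 2 * M < q \<Longrightarrow> geometric_potential q = sonic_level r0 v0 \<Longrightarrow> (v \<longlongrightarrow> k) (at q within ?I)"
        proof (rule transonic_free_state_exists[OF r0I assms(6) v0])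
          show "J \<subseteq> ?I" if "steady_Euler_through \<epsilon> k M r0 \<rho>0 v0 J \<sigma> w"
              "P_sonic \<epsilon> k M r0 v0 \<noteq> 0 \<or> (\<forall>r\<in>J. w r \<noteq> k)" for J \<sigma> w
          proof
            fix r assume r: "r \<in> J"
            have "\<not> lo \<le> r"
            proof
              assume "lo \<le> r"
              then have "lo \<in> J" using J[OF that(1)] r r0I unfolding is_interval_1 by fastforce
              then show False using gap[OF that] lohi by fastforce
            qed
            then show "r \<in> ?I" using sub[OF that(1)] r by auto
          qed
        qed (use level lohi in \<open>auto simp: is_interval_1 L_def\<close>)
        have "at lo within ?I = at_left lo"
          using lohi(1) by (intro at_within_nhd[of _ "{2 * M<..}"]) auto
        then have v_lim: "(v \<longlongrightarrow> k) (at_left lo)" using st(3)[of lo] lohi edge by (simp add: L_def)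
        show ?thesis
        proof (rule exI[of _ ?I], rule exI[of _ \<rho>], rule exI[of _ v], intro conjI ballI impI, goal_cases)
          case 4
          show ?case unfolding rc
            by (rule exI[of _ lo], rule exI[of _ hi]) (use sonic left lohi v_lim in auto)
        qed (use st nonpos in auto)
      next
        case right: False
        let ?I = "{hi<..}"
        have r0I: "r0 \<in> ?I" using right r0 lohi by auto
        obtain \<rho> v where st: "is_the_steady_state \<epsilon> k M r0 \<rho>0 v0 ?I \<rho> v"
            "\<And>r. r \<in> ?I \<Longrightarrow> sgn (v r - k) = sgn (v0 - k)"
            "\<And>q. 2 * M < q \<Longrightarrow> geometric_potential q = sonic_level r0 v0 \<Longrightarrow> (v \<longlongrightarrow> k) (at q within ?I)"
        proof (rule transonic_free_state_exists[OF r0I assms(6) v0])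
          show "J \<subseteq> ?I" if "steady_Euler_through \<epsilon> k M r0 \<rho>0 v0 J \<sigma> w"
              "P_sonic \<epsilon> k M r0 v0 \<noteq> 0 \<or> (\<forall>r\<in>J. w r \<noteq> k)" for J \<sigma> w
          proof
            fix r assume r: "r \<in> J"
            have "\<not> r \<le> hi"
            proof
              assume "r \<le> hi"
              then have "hi \<in> J" using J[OF that(1)] r r0I unfolding is_interval_1 by fastforce
              then show False using gap[OF that] lohi by fastforce
            qed
            then show "r \<in> ?I" by auto
          qed
        qed (use level lohi in \<open>auto simp: is_interval_1 L_def\<close>)
        have v_lim: "(v \<longlongrightarrow> k) (at_right hi)" using st(3)[of hi] lohi edge by (simp add: L_def)
        show ?thesis
        proof (rule exI[of _ ?I], rule exI[of _ \<rho>], rule exI[of _ v], intro conjI ballI impI, goal_cases)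
          case 4
          show ?case unfolding rc
            by (rule exI[of _ lo], rule exI[of _ hi]) (use sonic right lohi v_lim in auto)
        qed (use st nonpos in auto)
      qed
    qed
  qed
qed

end
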